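(* Consider the clipped GLM with sparsity prior described in the context. Let $a_n>1$ and let $\lambda_n$ satisfy Assumption $\mathcal{L}_0$: $\mathcal{M}(A,X)/d_n\le\lambda_n\le\mathcal{M}(A,X)\sqrt{\log d_n}$. Let $n,d_n\to\infty$ with $d_n>n$, let $\{b_n\}$ be a positive sequence with $b_n=o(n/\log d_n)$, and consider $n$ large enough that $b_n\log d_n<n$. Assume IC(Model) and IC(Joint) hold (see context), and let $\mathcal{B}_n=\mathcal{B}_{1,n}\cap\mathcal{B}_{2,n}$. Then, for all sufficiently large $n$, $$\sup_{\beta^*\in\mathcal{B}_n}\mathbb{E}\Big[\Pi_n\Big(|\mathrm{supp}(\beta)|>s_n^*\Big[1+\frac{8}{a_n-1}\Big(1+\frac{49\,\mathcal{M}^2(A,X)}{8\,\phi_1^2(A,X,S^* )}\Big)\Big]\ \Big|\ Y^{(n)}\Big)\Big]\to 0\quad\text{as } n\to\infty,$$ where the expectation is with respect to the data generating distribution with parameter $\beta^*$, $S^*=\mathrm{supp}(\beta^* )$, $s_n^*=|S^*|$.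
   Context: Exponential family: $f(y\mid\theta)=h(y)\exp[\theta T(y)-A(\theta)]$, $y\in\mathcal{Y}\subset\mathbb{R}$, with convex log-partition function $A$ such that $A''$ exists everywhere on the domain of $A$ and, for every $b\in(0,\infty]$, $\mathcal{I}_A(b):=\{t:0\le A''(t)\le b\}$ is an interval. Clipping function: there is a constant $\mathcal{M}_0(A)>0$ such that $\eta:\mathbb{R}\to\mathcal{I}_A(\mathcal{M}_0^2(A)/2)$ is Lipschitz and injective. Design matrix $X\in\mathbb{R}^{n\times d_n}$ with rows $x_i^{\mathrm T}$; for $\beta\in\mathbb{R}^{d_n}$, $\eta_i=\eta(x_i^{\mathrm T}\beta)$; for the truth $\beta^*$, $\eta_i^*=\eta(x_i^{\mathrm T}\beta^* )$. Observations $y_i$ independent with density $h(y_i)\exp(T_i\eta_i^*-A(\eta_i^* ))$, $T_i=T(y_i)$, $Y^{(n)}=(y_1,\dots,y_n)$. For parameters $\beta_1,\beta_2$ with corresponding $\eta_1,\eta_2$, $\mathcal{D}_n(\eta_1\|\eta_2)=\sum_i[A(\eta_{2,i})-A(\eta_{1,i})-(\eta_{2,i}-\eta_{1,i})A'(\eta_{1,i})]$. $Z_n(\eta,\eta^* )=\sum_i(T_i-\mathbb{E}T_i)(\eta_i-\eta_i^* )$, $L_n(\eta,\eta^* )=Z_n(\eta,\eta^* )-\mathcal{D}_n(\eta^*\|\eta)$. Prior: $\beta_S$ is $\beta$ with coordinates outside $S$ set to zero; $\Pi_n(S,\beta)=C_n\binom{d_n}{|S|}^{-1}(\lambda_n/(2d_n^{a_n}))^{|S|}\exp(-\lambda_n\|\beta_S\|_1)\delta_0(\beta_{S^c})$,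 $C_n$ normalizing the weights $\omega_n(s)=C_nd_n^{-a_ns}$, $\Pi_n(\beta)=\sum_S\Pi_n(S,\beta)$; posterior $\Pi_n(B\mid Y^{(n)})=\int_B e^{L_n(\eta,\eta^* )}\Pi_n(\beta)d\beta/\int e^{L_n(\eta,\eta^* )}\Pi_n(\beta)d\beta$. Constants: $\|X\|_{(\infty,\infty)}=\max_{i,j}X_{i,j}$, $\mathcal{M}_1(A)=(1\wedge\mathcal{M}_0^{-1}(A))^{-1}$, $\mathcal{M}(A,X)=\|X\|_{(\infty,\infty)}\mathcal{M}_1(A)$. IC quantities: for each $S\subset\{1,\dots,d_n\}$, $\phi_1(A,X,S)\ge0$ is a quantity such that for all $\beta_1,\beta_2\in\mathbb{R}^{d_n}$ with $\beta_{1S}\ne\beta_{2S}$ and $\|\beta_{2S^c}-\beta_{1S^c}\|_1<7\|\beta_{2S}-\beta_{1S}\|_1$ one has $\mathcal{D}_n(\eta_1\|\eta_2)\ge \frac{n\phi_1^2(A,X,S)}{|S|}\|\beta_{2S}-\beta_{1S}\|_1^2$. IC(Model): there is at least one nonempty $S$ with $\phi_1(A,X,S)>0$. $\mathcal{B}_{1,n}=\{\beta:\phi_1(A,X,\mathrm{supp}(\beta))>0\}$, $\mathcal{B}_{2,n}=\{\beta:0<|\mathrm{supp}(\beta)|\le b_n\}$. IC(Joint): $\mathcal{B}_n:=\mathcal{B}_{1,n}\cap\mathcal{B}_{2,n}$ is nonempty.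
   Formalization: The norm of X is taken as the maximum of |X_ij| instead of the printed maximum of X_ij; without absolute values the claim fails, e.g. for a Gaussian design with one column of −1's and all other entries tiny and nonnegative. *)

theory Defs
  imports "HOL-Analysis.Analysis" "HOL-Probability.Probability" "HOL-Library.Landau_Symbols"
begin

definition Rd :: "nat \<Rightarrow> (nat \<Rightarrow> real) set" where
  "Rd d = {\<beta>. \<forall>j. d \<le> j \<longrightarrow> \<beta> j = 0}"

definition supp :: "(nat \<Rightarrow> real) \<Rightarrow> nat set" where
  "supp \<beta> = {j. \<beta> j \<noteq> 0}"

definition restr :: "nat set \<Rightarrow> (nat \<Rightarrow> real) \<Rightarrow> nat \<Rightarrow> real" where
  "restr S \<beta> = (\<lambda>j. if j \<in> S then \<beta> j else 0)"

definition l1norm :: "nat set \<Rightarrow> (nat \<Rightarrow> real) \<Rightarrow> real" where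
  "l1norm I v = (\<Sum>j\<in>I. \<bar>v j\<bar>)"

definition etas :: "(real \<Rightarrow> real) \<Rightarrow> (nat \<Rightarrow> nat \<Rightarrow> real) \<Rightarrow> nat \<Rightarrow> (nat \<Rightarrow> real) \<Rightarrow> nat \<Rightarrow> real" where
  "etas \<eta> Xn d \<beta> i = \<eta> (\<Sum>j<d. Xn i j * \<beta> j)"

definition IA :: "real set \<Rightarrow> (real \<Rightarrow> real) \<Rightarrow> ereal \<Rightarrow> real set" where
  "IA Theta A2 b = {t \<in> Theta. 0 \<le> A2 t \<and> ereal (A2 t) \<le> b}"

text \<open>D_n(eta1 || eta2), A1 = A'.\<close>
definition Dn :: "(real \<Rightarrow> real) \<Rightarrow> (real \<Rightarrow> real) \<Rightarrow> nat \<Rightarrow> (nat \<Rightarrow> real) \<Rightarrow> (nat \<Rightarrow> real) \<Rightarrow> real" where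
  "Dn A A1 n e1 e2 = (\<Sum>i<n. A (e2 i) - A (e1 i) - (e2 i - e1 i) * A1 (e1 i))"

definition expfam_dens :: "(real \<Rightarrow> real) \<Rightarrow> (real \<Rightarrow> real) \<Rightarrow> (real \<Rightarrow> real) \<Rightarrow> real \<Rightarrow> real \<Rightarrow> real" where
  "expfam_dens h T A \<theta> y = h y * exp (\<theta> * T y - A \<theta>)"

definition ET :: "real measure \<Rightarrow> (real \<Rightarrow> real) \<Rightarrow> (real \<Rightarrow> real) \<Rightarrow> (real \<Rightarrow> real) \<Rightarrow> real \<Rightarrow> real" where
  "ET \<mu> h T A \<theta> = (\<integral>y. T y * expfam_dens h T A \<theta> y \<partial>\<mu>)"

definition Ln :: "real measure \<Rightarrow> (real \<Rightarrow> real) \<Rightarrow> (real \<Rightarrow> real) \<Rightarrow> (real \<Rightarrow> real) \<Rightarrow> (real \<Rightarrow> real)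
    \<Rightarrow> nat \<Rightarrow> (nat \<Rightarrow> real) \<Rightarrow> (nat \<Rightarrow> real) \<Rightarrow> (nat \<Rightarrow> real) \<Rightarrow> real" where
  "Ln \<mu> h T A A1 n Y e es =
     (\<Sum>i<n. (T (Y i) - ET \<mu> h T A (es i)) * (e i - es i)) - Dn A A1 n es e"

text \<open>Normalizing constant C_n of the weights omega_n(s) = C_n d^(-a s), s = 0..d.\<close>
definition prior_const :: "real \<Rightarrow> nat \<Rightarrow> real" where
  "prior_const a d = inverse (\<Sum>s\<le>d. real d powr (- a * real s))"

text \<open>Integral of a nonnegative function g against the spike-and-slab prior Pi_n:
  sum over S of C_n binom(d,|S|)^{-1} (lambda/(2 d^a))^{|S|} times the integral over
  R^S (Lebesgue) of exp(-lambda ||beta_S||_1) g(beta_S), with beta_{S^c} = 0.\<close>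
definition prior_integral :: "real \<Rightarrow> real \<Rightarrow> nat \<Rightarrow> ((nat \<Rightarrow> real) \<Rightarrow> real) \<Rightarrow> ennreal" where
  "prior_integral a lam d g =
     (\<Sum>S\<in>Pow {0..<d}.
        ennreal (prior_const a d * inverse (real (d choose card S)) * (lam / (2 * real d powr a)) ^ card S)
        * (\<integral>\<^sup>+ f. ennreal (exp (- lam * l1norm S f) * g (restr S f)) \<partial>(PiM S (\<lambda>_. lborel))))"

definition posterior :: "real measure \<Rightarrow> (real \<Rightarrow> real) \<Rightarrow> (real \<Rightarrow> real) \<Rightarrow> (real \<Rightarrow> real) \<Rightarrow> (real \<Rightarrow> real)
    \<Rightarrow> (real \<Rightarrow> real) \<Rightarrow> (nat \<Rightarrow> nat \<Rightarrow> real) \<Rightarrow> nat \<Rightarrow> nat \<Rightarrow> real \<Rightarrow> real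
    \<Rightarrow> (nat \<Rightarrow> real) \<Rightarrow> (nat \<Rightarrow> real) \<Rightarrow> ((nat \<Rightarrow> real) \<Rightarrow> bool) \<Rightarrow> ennreal" where
  "posterior \<mu> h T A A1 \<eta> Xn n d a lam \<beta>s Y P =
     prior_integral a lam d
        (\<lambda>\<beta>. exp (Ln \<mu> h T A A1 n Y (etas \<eta> Xn d \<beta>) (etas \<eta> Xn d \<beta>s)) * of_bool (P \<beta>))
     / prior_integral a lam d
        (\<lambda>\<beta>. exp (Ln \<mu> h T A A1 n Y (etas \<eta> Xn d \<beta>) (etas \<eta> Xn d \<beta>s)))"

definition data_measure :: "real measure \<Rightarrow> (real \<Rightarrow> real) \<Rightarrow> (real \<Rightarrow> real) \<Rightarrow> (real \<Rightarrow> real)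
    \<Rightarrow> nat \<Rightarrow> (nat \<Rightarrow> real) \<Rightarrow> (nat \<Rightarrow> real) measure" where
  "data_measure \<mu> h T A n es = PiM {0..<n} (\<lambda>i. density \<mu> (\<lambda>y. ennreal (expfam_dens h T A (es i) y)))"

text \<open>||X||_(inf,inf) (read as max |X_ij|), M_1(A), M(A,X).\<close>
definition normX :: "(nat \<Rightarrow> nat \<Rightarrow> real) \<Rightarrow> nat \<Rightarrow> nat \<Rightarrow> real" where
  "normX Xn n d = Max {\<bar>Xn i j\<bar> | i j. i < n \<and> j < d}"

definition M1 :: "real \<Rightarrow> real" where
  "M1 M0 = inverse (min 1 (inverse M0))"

definition McalAX :: "real \<Rightarrow> (nat \<Rightarrow> nat \<Rightarrow> real) \<Rightarrow> nat \<Rightarrow> nat \<Rightarrow> real" where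
  "McalAX M0 Xn n d = normX Xn n d * M1 M0"

end

theory Submission
  imports Defs "HOL-Real_Asymp.Real_Asymp"
begin

text \<open>
  The expected likelihood ratio is one, so that powers \<open>exp (c L)\<close> with \<open>0 \<le> c \<le> 1\<close> have expectation
  at most one under the truth \<open>\<beta>\<^sup>*\<close>. Write \<open>L = (1 - \<gamma>) L + \<gamma> L\<close>. On the event
  \<open>\<Sum>\<^sub>i \<bar>T\<^sub>i - E T\<^sub>i\<bar> \<le> n C g\<close>, which by Markov's inequality has probability at least \<open>1 - 1/g\<close>, the noise is
  at most \<open>K \<parallel>X\<parallel> n C g \<parallel>\<beta> - \<beta>\<^sup>*\<parallel>\<^sub>1\<close>. Choosing \<open>\<gamma>\<close> so that \<open>\<gamma>\<close> times this factor is \<open>\<lambda>/4\<close>, the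
  compatibility condition gives
  \<open>\<gamma> L + \<lambda> (\<parallel>\<beta>\<^sup>*\<parallel>\<^sub>1 - \<parallel>\<beta>\<parallel>\<^sub>1) \<le> Q - \<lambda>/4 \<parallel>\<beta> - \<beta>\<^sup>*\<parallel>\<^sub>1\<close> with \<open>Q = s\<^sup>* log d M\<^sup>2/\<phi>\<^sup>2\<close>.
  Integrating against the slab costs only \<open>4\<^bsup>|S|\<^esup>\<close>, which the factor \<open>d\<^bsup>-a|S|\<^esup>\<close> of the prior dominates.
  The normalizer of the posterior is bounded below by the contribution of a cube of side of order
  \<open>1/(\<parallel>X\<parallel> d)\<close> around \<open>\<beta>\<^sup>*\<close> in the model \<open>supp \<beta>\<^sup>*\<close>. The slowly growing choice \<open>g = (log d)\<^bsup>1/4\<^esup>\<close> absorbs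
  the Lipschitz and moment constants, although they do not appear in the threshold.
\<close>

subsection \<open>Regular exponential families\<close>

lemma two_plus_square_le_exp: "2 + x\<^sup>2 \<le> exp x + exp (- x)" for x :: real
proof -
  have "\<bar>x / 2\<bar> \<le> \<bar>sinh (x / 2)\<bar>"
    using real_le_abs_sinh[of "x / 2"] by (simp add: sinh_field_def exp_minus)
  then have "(x / 2)\<^sup>2 \<le> (sinh (x / 2))\<^sup>2"
    by (metis abs_le_square_iff)
  moreover have "exp x + exp (- x) = 2 + 4 * (sinh (x / 2))\<^sup>2"
    using cosh_double[of "x / 2"] cosh_square_eq[of "x / 2"] cosh_plus_sinh[of x] cosh_minus_sinh[of x] by simp
  ultimately show ?thesis
    by (simp add: power_divide)
qed

text \<open>Exponentials at two opposite tilts dominate the absolute value, so that integrability of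
  \<open>T\<close> and its mean absolute deviation both reduce to moment generating functions near
  the given parameter.\<close>

lemma abs_le_exp_sum:
  fixes x s :: real
  assumes "0 < s"
  shows "\<bar>x\<bar> \<le> 1 + (exp (s * x) + exp (- (s * x)) - 2) / s\<^sup>2"
proof -
  have "s\<^sup>2 * x\<^sup>2 \<le> exp (s * x) + exp (- (s * x)) - 2"
    using two_plus_square_le_exp[of "s * x"] by (simp add: power_mult_distrib)
  then have "x\<^sup>2 \<le> (exp (s * x) + exp (- (s * x)) - 2) / s\<^sup>2"
    using assms by (simp add: field_simps)
  moreover have "\<bar>x\<bar> \<le> 1 + x\<^sup>2"
    using zero_le_power2[of "\<bar>x\<bar> - 1 / 2"] by (simp add: power2_diff field_simps power_divide)
  ultimately show ?thesis by linarith
qed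

lemma exp_le_1_plus_double:
  fixes x :: real
  assumes "0 \<le> x" "x \<le> 1"
  shows "exp x \<le> 1 + 2 * x"
  using exp_bound[OF assms] power_le_one[OF assms, of 1] assms
  by (smt (verit) mult_left_le power2_eq_square)

lemma MVT_unordered:
  fixes f f' :: "real \<Rightarrow> real"
  assumes "s \<noteq> t"
    and "\<And>x. min s t \<le> x \<Longrightarrow> x \<le> max s t \<Longrightarrow> (f has_real_derivative f' x) (at x)"
  obtains x where "min s t < x" "x < max s t" "f t - f s = (t - s) * f' x"
proof (cases "s < t")
  case True
  then show ?thesis
    using MVT2[of s t f f'] assms that by (auto simp: min_def max_def)
next
  case False
  then have "t < s" using assms by auto
  then obtain x where "t < x" "x < s" "f s - f t = (s - t) * f' x"
    using MVT2[of t s f f'] assms by (auto simp: min_def max_def)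
  then show ?thesis
    by (intro that[of x]) (auto simp: algebra_simps)
qed

text \<open>\<open>I\<close> will be the range of the clipping map. Its openness leaves room for
  small tilts in both directions. Stating \<open>integral_kernel\<close> with
  \<open>exp (A \<theta>)\<close> builds in a positive normalizing integral, which a statement
  through the logarithm would not.\<close>

locale regular_exponential_family =
  fixes \<mu> :: "real measure" and h T A A1 A2 :: "real \<Rightarrow> real" and I :: "real set" and m :: real
  assumes sets_base [measurable_cong]: "sets \<mu> = sets borel"
    and h_meas [measurable]: "h \<in> borel_measurable borel" and h_nonneg: "\<And>y. 0 \<le> h y"
    and T_meas [measurable]: "T \<in> borel_measurable borel"
    and open_I: "open I" and interval_I: "is_interval I"
    and integrable_kernel: "\<And>\<theta>. \<theta> \<in> I \<Longrightarrow> integrable \<mu> (\<lambda>y. h y * exp (\<theta> * T y))"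
    and integral_kernel: "\<And>\<theta>. \<theta> \<in> I \<Longrightarrow> (\<integral>y. h y * exp (\<theta> * T y) \<partial>\<mu>) = exp (A \<theta>)"
    and A_deriv: "\<And>t. t \<in> I \<Longrightarrow> (A has_real_derivative A1 t) (at t)"
    and A1_deriv: "\<And>t. t \<in> I \<Longrightarrow> (A1 has_real_derivative A2 t) (at t)"
    and A2_nonneg: "\<And>t. t \<in> I \<Longrightarrow> 0 \<le> A2 t" and A2_le: "\<And>t. t \<in> I \<Longrightarrow> A2 t \<le> m"
begin

abbreviation dens :: "real \<Rightarrow> real \<Rightarrow> real" where
  "dens \<equiv> expfam_dens h T A"

definition law :: "real \<Rightarrow> real measure" where
  "law \<theta> = density \<mu> (\<lambda>y. ennreal (dens \<theta> y))"

lemma dens_nonneg: "0 \<le> dens \<theta> y"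
  by (simp add: expfam_dens_def h_nonneg)

lemma dens_meas [measurable]: "dens \<theta> \<in> borel_measurable borel"
  unfolding expfam_dens_def by measurable

lemma sets_law [simp, measurable_cong]: "sets (law \<theta>) = sets borel"
  by (simp add: law_def sets_base)

text \<open>Exponential tilting stays inside the family; the moment generating function of
  \<open>T\<close> and the likelihood ratio are both instances.\<close>

lemma dens_shift: "exp (s * T y - (A (\<theta> + s) - A \<theta>)) * dens \<theta> y = dens (\<theta> + s) y"
  by (simp add: expfam_dens_def exp_add[symmetric] exp_diff algebra_simps) (simp add: exp_add algebra_simps)

lemma dens_eq: "dens \<theta> y = exp (- A \<theta>) * (h y * exp (\<theta> * T y))"
  by (simp add: expfam_dens_def exp_diff exp_minus field_simps)

lemma
  assumes "\<theta> \<in> I"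
  shows integrable_dens: "integrable \<mu> (dens \<theta>)" and integral_dens: "(\<integral>y. dens \<theta> y \<partial>\<mu>) = 1"
  unfolding dens_eq using integrable_kernel[OF assms] integral_kernel[OF assms]
  by (simp_all flip: exp_add)

lemma nn_integral_dens: "\<theta> \<in> I \<Longrightarrow> (\<integral>\<^sup>+y. ennreal (dens \<theta> y) \<partial>\<mu>) = 1"
  using nn_integral_eq_integral[OF integrable_dens] integral_dens dens_nonneg by simp

lemma prob_space_law: "\<theta> \<in> I \<Longrightarrow> prob_space (law \<theta>)"
  by (rule prob_spaceI) (simp add: law_def emeasure_density nn_integral_dens cong: nn_integral_cong)

text \<open>The mean value theorem is applied to \<open>A\<close> and then to \<open>A1\<close>,
  which asks for no continuity of \<open>A2\<close>. The cost is the factor 1/2 of Taylor's bound,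
  since the first intermediate point is only known to lie between \<open>s\<close> and
  \<open>t\<close>.\<close>

lemma bregman_bounds:
  assumes "s \<in> I" "t \<in> I"
  shows "0 \<le> A t - A s - (t - s) * A1 s" and "A t - A s - (t - s) * A1 s \<le> m * (t - s)\<^sup>2"
proof -
  \<comment> \<open>For \<open>s \<noteq> t\<close>, \<open>q\<close> is the curvature at the second
    intermediate point and \<open>r\<close> the relative position of the first one in the segment
    from \<open>s\<close> to \<open>t\<close>.\<close>
  have "\<exists>q. 0 \<le> q \<and> q \<le> m \<and> (\<exists>r. 0 \<le> r \<and> r \<le> 1 \<and> A t - A s - (t - s) * A1 s = q * r * (t - s)\<^sup>2)"
  proof (cases "s = t")
    case True
    then show ?thesis
      using A2_nonneg[OF assms(1)] A2_le[OF assms(1)] by (intro exI[of _ "A2 s"] conjI exI[of _ 0]) auto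
  next
    case False
    have seg: "x \<in> I" if "min s t \<le> x" "x \<le> max s t" for x
      using mem_is_interval_1_I[OF interval_I, of "min s t" "max s t" x] assms that
      by (simp add: min_def max_def)
    obtain x where x: "min s t < x" "x < max s t" and eqA: "A t - A s = (t - s) * A1 x"
      by (rule MVT_unordered[OF False, of A A1]) (auto intro: A_deriv seg)
    have xs: "s \<noteq> x" using x by auto
    have "(A1 has_real_derivative A2 y) (at y)" if "min s x \<le> y" "y \<le> max s x" for y
      using that x by (intro A1_deriv seg) (auto simp: min_def max_def split: if_splits)
    then obtain y where y: "min s x < y" "y < max s x" and eqA1: "A1 x - A1 s = (x - s) * A2 y"
      by (rule MVT_unordered[OF xs, of A1 A2])
    have yI: "y \<in> I" using x y by (intro seg) (auto simp: min_def max_def split: if_splits)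
    have "A t - A s - (t - s) * A1 s = (t - s) * (A1 x - A1 s)"
      using eqA by (simp add: algebra_simps)
    then have "A t - A s - (t - s) * A1 s = (t - s) * ((x - s) * A2 y)"
      unfolding eqA1 .
    also have "\<dots> = A2 y * ((x - s) / (t - s)) * (t - s)\<^sup>2"
      using False by (simp add: field_simps power2_eq_square)
    finally have "A t - A s - (t - s) * A1 s = A2 y * ((x - s) / (t - s)) * (t - s)\<^sup>2" .
    moreover have "0 \<le> (x - s) / (t - s)" "(x - s) / (t - s) \<le> 1"
      using x by (auto simp: min_def max_def divide_simps split: if_splits)
    ultimately show ?thesis using A2_nonneg[OF yI] A2_le[OF yI] by blast
  qed
  then obtain q r where qr: "0 \<le> q" "q \<le> m" "0 \<le> r" "r \<le> 1"
      "A t - A s - (t - s) * A1 s = q * r * (t - s)\<^sup>2" by blast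
  then show "0 \<le> A t - A s - (t - s) * A1 s" by simp
  have "q * r \<le> m" using qr by (smt (verit) mult_left_le)
  then show "A t - A s - (t - s) * A1 s \<le> m * (t - s)\<^sup>2"
    using qr(5) by (simp add: mult_right_mono)
qed

lemma m_nonneg: "I \<noteq> {} \<Longrightarrow> 0 \<le> m"
  using A2_nonneg A2_le by (meson all_not_in_conv order_trans)

lemma exists_step:
  assumes "\<theta> \<in> I" "0 < c"
  obtains s where "0 < s" "s \<le> c" "\<And>u. \<bar>u\<bar> \<le> s \<Longrightarrow> \<theta> + u \<in> I"
proof -
  obtain e where e: "0 < e" "ball \<theta> e \<subseteq> I"
    using open_I assms(1) by (meson openE)
  show ?thesis
  proof (rule that[of "min c (e / 2)"])
    show "\<theta> + u \<in> I" if "\<bar>u\<bar> \<le> min c (e / 2)" for u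
    proof -
      have "\<theta> + u \<in> ball \<theta> e" using that e by (simp add: dist_real_def)
      then show ?thesis using e by blast
    qed
  qed (use assms e in auto)
qed

lemma exp_tilt:
  assumes "\<theta> + s \<in> I"
  shows "integrable \<mu> (\<lambda>y. exp (s * T y) * dens \<theta> y)"
    and "(\<integral>y. exp (s * T y) * dens \<theta> y \<partial>\<mu>) = exp (A (\<theta> + s) - A \<theta>)"
proof -
  have *: "exp (s * T y) * dens \<theta> y = exp (A (\<theta> + s) - A \<theta>) * dens (\<theta> + s) y" for y
    by (simp add: dens_shift[symmetric] flip: exp_add)
  show "integrable \<mu> (\<lambda>y. exp (s * T y) * dens \<theta> y)"
    "(\<integral>y. exp (s * T y) * dens \<theta> y \<partial>\<mu>) = exp (A (\<theta> + s) - A \<theta>)"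
    unfolding * using integrable_dens[OF assms] integral_dens[OF assms] by simp_all
qed

lemma integrable_T: 
  assumes "\<theta> \<in> I"
  shows "integrable \<mu> (\<lambda>y. T y * dens \<theta> y)"
proof -
  obtain s where s: "0 < s" "\<And>u. \<bar>u\<bar> \<le> s \<Longrightarrow> \<theta> + u \<in> I"
    using exists_step[OF assms, of 1] by auto
  let ?g = "\<lambda>y. dens \<theta> y + (exp (s * T y) * dens \<theta> y + exp (- s * T y) * dens \<theta> y - 2 * dens \<theta> y) / s\<^sup>2"
  have I: "\<theta> + s \<in> I" "\<theta> + - s \<in> I" using s(1) by (auto intro!: s(2) simp del: add_uminus_conv_diff)
  have int: "integrable \<mu> ?g"
    by (intro Bochner_Integration.integrable_add Bochner_Integration.integrable_diff
        integrable_divide integrable_mult_right exp_tilt(1)[OF I(1)] exp_tilt(1)[OF I(2)] integrable_dens[OF assms])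
  have "\<bar>T y * dens \<theta> y\<bar> \<le> \<bar>?g y\<bar>" for y
  proof -
    have "\<bar>T y\<bar> * dens \<theta> y \<le> (1 + (exp (s * T y) + exp (- (s * T y)) - 2) / s\<^sup>2) * dens \<theta> y"
      by (intro mult_right_mono abs_le_exp_sum s dens_nonneg)
    also have "\<dots> = ?g y" by (simp add: algebra_simps add_divide_distrib diff_divide_distrib)
    finally show ?thesis using dens_nonneg[of \<theta> y] by (simp add: abs_mult)
  qed
  then have ae: "AE y in \<mu>. norm (T y * dens \<theta> y) \<le> norm (?g y)"
    by (intro AE_I2) (simp only: real_norm_def)
  show ?thesis
    by (rule Bochner_Integration.integrable_bound[OF int _ ae]) measurable
qed

text \<open>Since \<open>exp (s * T) \<ge> 1 + s * T\<close>, the function \<open>s \<mapsto> exp (A (\<theta> + s) - A \<theta>) - 1 - s * E T\<close>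
  has a local minimum at \<open>0\<close>; this identifies the mean without differentiating under the integral.\<close>

lemma ET_eq:
  assumes "\<theta> \<in> I"
  shows "ET \<mu> h T A \<theta> = A1 \<theta>"
proof -
  let ?E = "ET \<mu> h T A \<theta>"
  let ?f = "\<lambda>s. exp (A (\<theta> + s) - A \<theta>) - 1 - s * ?E"
  obtain s where s: "0 < s" "\<And>u. \<bar>u\<bar> \<le> s \<Longrightarrow> \<theta> + u \<in> I"
    using exists_step[OF assms, of 1] by auto
  have nonneg: "0 \<le> ?f u" if "\<bar>u\<bar> \<le> s" for u
  proof -
    have "(\<integral>y. dens \<theta> y + u * (T y * dens \<theta> y) \<partial>\<mu>) \<le> (\<integral>y. exp (u * T y) * dens \<theta> y \<partial>\<mu>)"
    proof (rule integral_mono)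
      show "dens \<theta> y + u * (T y * dens \<theta> y) \<le> exp (u * T y) * dens \<theta> y" for y
        using mult_right_mono[OF exp_ge_add_one_self[of "u * T y"] dens_nonneg[of \<theta> y]]
        by (simp add: algebra_simps)
    qed (use integrable_dens[OF assms] integrable_T[OF assms] exp_tilt(1)[OF s(2)[OF that]] in auto)
    then show ?thesis
      using integrable_dens[OF assms] integrable_T[OF assms] integral_dens[OF assms]
        exp_tilt(2)[OF s(2)[OF that]] by (simp add: ET_def)
  qed
  have "(A has_real_derivative A1 \<theta>) (at (\<theta> + 0))" using A_deriv[OF assms] by simp
  then have "((\<lambda>u. A (\<theta> + u)) has_real_derivative A1 \<theta>) (at 0)"
    using DERIV_shift[of A "A1 \<theta>" 0 \<theta>] by (simp add: add.commute)
  then have "(?f has_real_derivative A1 \<theta> - ?E) (at 0)"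
    by (auto intro!: derivative_eq_intros)
  then have "A1 \<theta> - ?E = 0"
    by (rule DERIV_local_min[OF _ s(1)]) (use nonneg in auto)
  then show ?thesis by simp
qed

text \<open>The centred exponential moments at \<open>s\<close> and \<open>- s\<close> are at most
  \<open>exp (m * s\<^sup>2)\<close> by the Bregman bound. Dividing their excess over 1 by
  \<open>s\<^sup>2\<close> leaves a constant free of \<open>s\<close> and \<open>\<theta>\<close>,
  hence uniform over the truth.\<close>

lemma mean_abs_deviation:
  assumes "\<theta> \<in> I"
  shows "(\<integral>\<^sup>+y. ennreal \<bar>T y - A1 \<theta>\<bar> \<partial>(law \<theta>)) \<le> ennreal (1 + 4 * m)"
proof -
  have m: "0 \<le> m" using m_nonneg assms by auto
  \<comment> \<open>The cap on \<open>s\<close> forces \<open>m * s\<^sup>2 \<le> 1\<close>, the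
    range in which \<open>exp x \<le> 1 + 2 * x\<close> is available.\<close>
  obtain s where s: "0 < s" "s \<le> 1 / (1 + m)" "\<And>u. \<bar>u\<bar> \<le> s \<Longrightarrow> \<theta> + u \<in> I"
    using exists_step[OF assms, of "1 / (1 + m)"] m by auto
  have "s * (1 + m) \<le> 1" using s m by (simp add: field_simps)
  then have "s * m \<le> 1" "s \<le> 1" using s m by (auto simp: distrib_left intro: order_trans[rotated])
  then have "s * (s * m) \<le> 1 * 1"
    using s m by (intro mult_mono) auto
  then have ms: "m * s\<^sup>2 \<le> 1" by (simp add: power2_eq_square algebra_simps)
  have I: "\<theta> + s \<in> I" "\<theta> + - s \<in> I" using s(1) by (auto intro!: s(3) simp del: add_uminus_conv_diff)
  \<comment> \<open>These factors turn exponential moments of \<open>T\<close> into those of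
    \<open>T - A1 \<theta>\<close>.\<close>
  define c1 c2 where "c1 = exp (- (s * A1 \<theta>))" and "c2 = exp (s * A1 \<theta>)"
  let ?g = "\<lambda>y. dens \<theta> y + (c1 * (exp (s * T y) * dens \<theta> y) + c2 * (exp (- s * T y) * dens \<theta> y) - 2 * dens \<theta> y) / s\<^sup>2"
  have int: "integrable \<mu> ?g"
    by (intro Bochner_Integration.integrable_add Bochner_Integration.integrable_diff
        integrable_divide integrable_mult_right exp_tilt(1)[OF I(1)] exp_tilt(1)[OF I(2)] integrable_dens[OF assms])
  have le: "\<bar>T y - A1 \<theta>\<bar> * dens \<theta> y \<le> ?g y" for y
  proof -
    have "\<bar>T y - A1 \<theta>\<bar> * dens \<theta> y
        \<le> (1 + (exp (s * (T y - A1 \<theta>)) + exp (- (s * (T y - A1 \<theta>))) - 2) / s\<^sup>2) * dens \<theta> y"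
      by (intro mult_right_mono abs_le_exp_sum s dens_nonneg)
    also have "exp (s * (T y - A1 \<theta>)) = c1 * exp (s * T y)"
      by (simp add: c1_def algebra_simps flip: exp_add)
    also have "exp (- (s * (T y - A1 \<theta>))) = c2 * exp (- s * T y)"
      by (simp add: c2_def algebra_simps flip: exp_add)
    finally show ?thesis by (simp add: algebra_simps add_divide_distrib diff_divide_distrib)
  qed
  have e1: "c1 * exp (A (\<theta> + s) - A \<theta>) \<le> 1 + 2 * (m * s\<^sup>2)"
  proof -
    have "c1 * exp (A (\<theta> + s) - A \<theta>) = exp (A (\<theta> + s) - A \<theta> - ((\<theta> + s) - \<theta>) * A1 \<theta>)"
      by (simp add: c1_def algebra_simps flip: exp_add)
    also have "\<dots> \<le> exp (m * s\<^sup>2)" using bregman_bounds(2)[OF assms I(1)] by simp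
    also have "\<dots> \<le> 1 + 2 * (m * s\<^sup>2)" using ms m by (intro exp_le_1_plus_double) auto
    finally show ?thesis .
  qed
  have e2: "c2 * exp (A (\<theta> + - s) - A \<theta>) \<le> 1 + 2 * (m * s\<^sup>2)"
  proof -
    have "c2 * exp (A (\<theta> + - s) - A \<theta>) = exp (A (\<theta> + - s) - A \<theta> - ((\<theta> + - s) - \<theta>) * A1 \<theta>)"
      by (simp add: c2_def algebra_simps flip: exp_add)
    also have "\<dots> \<le> exp (m * s\<^sup>2)" using bregman_bounds(2)[OF assms I(2)] by simp
    also have "\<dots> \<le> 1 + 2 * (m * s\<^sup>2)" using ms m by (intro exp_le_1_plus_double) auto
    finally show ?thesis .
  qed
  have "(\<integral>\<^sup>+y. ennreal \<bar>T y - A1 \<theta>\<bar> \<partial>(law \<theta>)) = (\<integral>\<^sup>+y. ennreal (\<bar>T y - A1 \<theta>\<bar> * dens \<theta> y) \<partial>\<mu>)"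
    unfolding law_def by (subst nn_integral_density) (auto simp: mult.commute ennreal_mult' dens_nonneg)
  also have "\<dots> \<le> (\<integral>\<^sup>+y. ennreal (?g y) \<partial>\<mu>)"
    by (intro nn_integral_mono ennreal_leI le)
  also have "\<dots> = ennreal (\<integral>y. ?g y \<partial>\<mu>)"
    using int order_trans[OF mult_nonneg_nonneg[OF abs_ge_zero dens_nonneg] le]
    by (intro nn_integral_eq_integral) auto
  also have "(\<integral>y. ?g y \<partial>\<mu>)
      = 1 + (c1 * exp (A (\<theta> + s) - A \<theta>) + c2 * exp (A (\<theta> + - s) - A \<theta>) - 2) / s\<^sup>2"
    using exp_tilt[OF I(1)] exp_tilt[OF I(2)] integrable_dens[OF assms] integral_dens[OF assms] by simp
  also have "\<dots> \<le> 1 + (4 * (m * s\<^sup>2)) / s\<^sup>2"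
    using e1 e2 s by (intro add_left_mono divide_right_mono) auto
  also have "\<dots> = 1 + 4 * m" using s by simp
  finally show ?thesis using ennreal_leI by simp
qed

end

subsection \<open>The likelihood ratio in the clipped model\<close>

lemma nn_integral_laplace_le:
  fixes b c :: real
  assumes "0 < c"
  shows "(\<integral>\<^sup>+x. ennreal (exp (- (c * \<bar>x - b\<bar>))) \<partial>lborel) \<le> ennreal (2 / c)"
proof -
  let ?f = "exponential_density c"
  have 1: "(\<integral>\<^sup>+x. ennreal (?f x) \<partial>lborel) = 1"
    using nn_integral_erlang_density[of c 0] prob_space.emeasure_space_1[OF prob_space_exponential_density[OF assms]]
    by (simp add: emeasure_density)
  have up: "(\<integral>\<^sup>+x. ennreal (?f (x - b)) \<partial>lborel) = 1"
    using nn_integral_real_affine[of "\<lambda>x. ennreal (?f x)" 1 "- b"] 1 by (simp add: algebra_simps)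
  have down: "(\<integral>\<^sup>+x. ennreal (?f (b - x)) \<partial>lborel) = 1"
    using nn_integral_real_affine[of "\<lambda>x. ennreal (?f x)" "- 1" b] 1 by (simp add: algebra_simps)
  \<comment> \<open>At \<open>x = b\<close> both densities contribute, so this is an inequality
    rather than an equation; an upper bound on the slab mass is all that is wanted.\<close>
  have "exp (- (c * \<bar>x - b\<bar>)) \<le> 1 / c * (?f (x - b) + ?f (b - x))" for x
    using assms by (cases "b \<le> x") (auto simp: exponential_density_def algebra_simps)
  then have "(\<integral>\<^sup>+x. ennreal (exp (- (c * \<bar>x - b\<bar>))) \<partial>lborel)
      \<le> (\<integral>\<^sup>+x. ennreal (1 / c) * (ennreal (?f (x - b)) + ennreal (?f (b - x))) \<partial>lborel)"
    using assms by (intro nn_integral_mono)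
      (simp add: exponential_density_nonneg ennreal_leI flip: ennreal_plus ennreal_mult)
  also have "\<dots> = ennreal (1 / c) * 2"
    by (simp add: nn_integral_cmult nn_integral_add up down one_add_one)
  also have "\<dots> = ennreal (2 / c)"
    using assms by (simp flip: ennreal_numeral ennreal_mult)
  finally show ?thesis .
qed

text \<open>There are \<open>d choose k\<close> models of size \<open>k\<close>, so the inverse
  binomial in the prior turns a sum over models into a sum over sizes.\<close>

lemma sum_Pow_by_card:
  fixes F :: "nat \<Rightarrow> real"
  shows "(\<Sum>S\<in>Pow {0..<d}. inverse (real (d choose card S)) * F (card S)) = (\<Sum>k\<le>d. F k)"
proof -
  have "(\<Sum>S\<in>Pow {0..<d}. inverse (real (d choose card S)) * F (card S))
      = (\<Sum>k\<le>d. \<Sum>S | S \<in> Pow {0..<d} \<and> card S = k. inverse (real (d choose card S)) * F (card S))"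
    by (rule sum.group[symmetric]) (auto dest: card_mono[rotated])
  also have "\<dots> = (\<Sum>k\<le>d. F k)"
  proof (rule sum.cong[OF refl])
    fix k assume "k \<in> {..d}"
    have "(\<Sum>S | S \<in> Pow {0..<d} \<and> card S = k. inverse (real (d choose card S)) * F (card S))
        = (\<Sum>S | S \<subseteq> {0..<d} \<and> card S = k. inverse (real (d choose k)) * F k)"
      by (rule sum.cong) auto
    also have "\<dots> = real (d choose k) * (inverse (real (d choose k)) * F k)"
      using n_subsets[of "{0..<d}" k] by simp
    also have "\<dots> = F k" using \<open>k \<in> {..d}\<close> by simp
    finally show "(\<Sum>S | S \<in> Pow {0..<d} \<and> card S = k. inverse (real (d choose card S)) * F (card S)) = F k" .
  qed
  finally show ?thesis .
qed

lemma prod_mono_ennreal: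
  fixes f g :: "'a \<Rightarrow> ennreal"
  assumes "\<And>i. i \<in> S \<Longrightarrow> f i \<le> g i"
  shows "prod f S \<le> prod g S"
  using assms by (induction S rule: infinite_finite_induct) (auto intro!: mult_mono)

lemma l1norm_restr: "finite J \<Longrightarrow> S \<subseteq> J \<Longrightarrow> l1norm J (restr S f) = l1norm S f"
  unfolding l1norm_def by (rule sum.mono_neutral_cong_right) (auto simp: restr_def)

lemma l1norm_nonneg: "0 \<le> l1norm S v"
  by (simp add: l1norm_def sum_nonneg)

lemma restr_in_Rd: "S \<subseteq> {0..<d} \<Longrightarrow> restr S f \<in> Rd d"
  by (auto simp: Rd_def restr_def)

text \<open>With \<open>range \<eta>\<close> as parameter interval, every coefficient vector yields
  admissible natural parameters, whatever its size.\<close>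

locale clipped_glm = regular_exponential_family \<mu> h T A A1 A2 "range \<eta>" m
  for \<mu> :: "real measure" and h T A A1 A2 \<eta> :: "real \<Rightarrow> real" and m :: real +
  fixes K nX :: real and n d :: nat and X :: "nat \<Rightarrow> nat \<Rightarrow> real"
  assumes lip: "K-lipschitz_on UNIV \<eta>"
    and X_le: "\<And>i j. i < n \<Longrightarrow> j < d \<Longrightarrow> \<bar>X i j\<bar> \<le> nX"
begin

abbreviation et :: "(nat \<Rightarrow> real) \<Rightarrow> nat \<Rightarrow> real" where
  "et \<equiv> etas \<eta> X d"

abbreviation L :: "(nat \<Rightarrow> real) \<Rightarrow> (nat \<Rightarrow> real) \<Rightarrow> (nat \<Rightarrow> real) \<Rightarrow> real" where
  "L \<beta>s Y \<beta> \<equiv> Ln \<mu> h T A A1 n Y (et \<beta>) (et \<beta>s)"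

abbreviation data :: "(nat \<Rightarrow> real) \<Rightarrow> (nat \<Rightarrow> real) measure" where
  "data \<beta>s \<equiv> data_measure \<mu> h T A n (et \<beta>s)"

abbreviation l1 :: "(nat \<Rightarrow> real) \<Rightarrow> real" where
  "l1 \<equiv> l1norm {0..<d}"

text \<open>The total absolute noise controls the stochastic term for all coefficient vectors at
  once, so a single event serves the whole prior integral.\<close>

definition W :: "(nat \<Rightarrow> real) \<Rightarrow> (nat \<Rightarrow> real) \<Rightarrow> real" where
  "W \<beta>s Y = (\<Sum>i<n. \<bar>T (Y i) - A1 (et \<beta>s i)\<bar>)"

lemma et_in [simp]: "et \<beta> i \<in> range \<eta>"
  by (simp add: etas_def)

lemma K_nonneg: "0 \<le> K"
  using lip by (rule lipschitz_on_nonneg)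

lemma m_ge_0: "0 \<le> m"
  using m_nonneg by auto

lemma et_diff:
  assumes "i < n"
  shows "\<bar>et \<beta> i - et \<beta>' i\<bar> \<le> K * nX * l1 (\<beta> - \<beta>')"
proof -
  have "\<bar>et \<beta> i - et \<beta>' i\<bar> \<le> K * \<bar>(\<Sum>j<d. X i j * \<beta> j) - (\<Sum>j<d. X i j * \<beta>' j)\<bar>"
    using lipschitz_onD[OF lip] by (simp add: etas_def dist_real_def)
  also have "(\<Sum>j<d. X i j * \<beta> j) - (\<Sum>j<d. X i j * \<beta>' j) = (\<Sum>j<d. X i j * (\<beta> j - \<beta>' j))"
    by (simp add: sum_subtractf right_diff_distrib)
  also have "\<bar>\<dots>\<bar> \<le> (\<Sum>j<d. nX * \<bar>\<beta> j - \<beta>' j\<bar>)"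
    by (rule order_trans[OF sum_abs]) (auto intro!: sum_mono mult_right_mono X_le assms simp: abs_mult)
  also have "\<dots> = nX * l1 (\<beta> - \<beta>')"
    by (simp add: l1norm_def sum_distrib_left lessThan_atLeast0)
  finally show ?thesis
    using K_nonneg by (simp add: mult_left_mono mult.assoc)
qed

lemma Dn_nonneg: "0 \<le> Dn A A1 n (et \<beta>s) (et \<beta>)"
  unfolding Dn_def by (intro sum_nonneg bregman_bounds) auto

lemma Dn_le: "Dn A A1 n (et \<beta>s) (et \<beta>) \<le> n * m * (K * nX * l1 (\<beta> - \<beta>s))\<^sup>2"
proof -
  have "Dn A A1 n (et \<beta>s) (et \<beta>) \<le> (\<Sum>i<n. m * (K * nX * l1 (\<beta> - \<beta>s))\<^sup>2)"
    unfolding Dn_def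
  proof (rule sum_mono)
    fix i assume "i \<in> {..<n}"
    then have "(et \<beta> i - et \<beta>s i)\<^sup>2 \<le> (K * nX * l1 (\<beta> - \<beta>s))\<^sup>2"
      using et_diff[of i \<beta> \<beta>s] by (simp add: abs_le_square_iff[symmetric])
    then show "A (et \<beta> i) - A (et \<beta>s i) - (et \<beta> i - et \<beta>s i) * A1 (et \<beta>s i) \<le> m * (K * nX * l1 (\<beta> - \<beta>s))\<^sup>2"
      using bregman_bounds(2)[of "et \<beta>s i" "et \<beta> i"] m_ge_0
      by (meson et_in mult_left_mono order_trans)
  qed
  then show ?thesis by simp
qed

lemma L_eq: "L \<beta>s Y \<beta> = (\<Sum>i<n. (T (Y i) - A1 (et \<beta>s i)) * (et \<beta> i - et \<beta>s i)) - Dn A A1 n (et \<beta>s) (et \<beta>)"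
  by (simp add: Ln_def ET_eq)

text \<open>Adding the divergence to \<open>L\<close> leaves only the centred noise. Holder's
  inequality separates it into \<open>W\<close> and the largest change of a natural
  parameter.\<close>

lemma L_plus_Dn_abs:
  "\<bar>L \<beta>s Y \<beta> + Dn A A1 n (et \<beta>s) (et \<beta>)\<bar> \<le> K * nX * W \<beta>s Y * l1 (\<beta> - \<beta>s)"
proof -
  have "\<bar>L \<beta>s Y \<beta> + Dn A A1 n (et \<beta>s) (et \<beta>)\<bar>
      \<le> (\<Sum>i<n. \<bar>T (Y i) - A1 (et \<beta>s i)\<bar> * (K * nX * l1 (\<beta> - \<beta>s)))"
    unfolding L_eq using et_diff
    by (auto intro!: order_trans[OF sum_abs] sum_mono mult_left_mono simp: abs_mult)
  then show ?thesis
    by (simp add: W_def sum_distrib_left sum_distrib_right algebra_simps)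
qed

text \<open>The terms with \<open>A1\<close> cancel between noise and divergence, so
  \<open>L\<close> is the genuine log-likelihood ratio.\<close>

lemma L_likelihood_ratio:
  "L \<beta>s Y \<beta> = (\<Sum>i<n. (et \<beta> i - et \<beta>s i) * T (Y i) - (A (et \<beta> i) - A (et \<beta>s i)))"
  unfolding L_eq Dn_def sum_subtractf[symmetric] by (rule sum.cong) (auto simp: algebra_simps)

section \<open>Integration over the product law of the data\<close>

lemma data_eq: "data \<beta>s = PiM {0..<n} (\<lambda>i. law (et \<beta>s i))"
  by (simp add: data_measure_def law_def)

lemma product_prob_data: "product_prob_space (\<lambda>i. law (et \<beta>s i))"
  using prob_space_law[OF et_in]
  by (intro product_prob_space.intro product_sigma_finite.intro product_prob_space_axioms.intro)
    (auto intro: prob_space_imp_sigma_finite)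

lemma prob_space_data: "prob_space (data \<beta>s)"
  unfolding data_eq by (rule prob_space_PiM) (simp add: prob_space_law)

lemma sets_data [simp, measurable_cong]: "sets (data \<beta>s) = sets (PiM {0..<n} (\<lambda>_. borel))"
  unfolding data_eq by (rule sets_PiM_cong) auto

text \<open>Independence factorizes the expectation, and each factor tilts the true density into the
  one at the other parameter, which has mass one.\<close>

lemma nn_integral_exp_L: "(\<integral>\<^sup>+Y. ennreal (exp (L \<beta>s Y \<beta>)) \<partial>(data \<beta>s)) = 1"
proof -
  interpret product_prob_space "\<lambda>i. law (et \<beta>s i)" by (rule product_prob_data)
  let ?F = "\<lambda>i y. exp ((et \<beta> i - et \<beta>s i) * T y - (A (et \<beta> i) - A (et \<beta>s i)))"
  have "(\<integral>\<^sup>+Y. ennreal (exp (L \<beta>s Y \<beta>)) \<partial>(data \<beta>s)) = (\<integral>\<^sup>+Y. (\<Prod>i\<in>{0..<n}. ennreal (?F i (Y i))) \<partial>(data \<beta>s))"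
    by (simp add: L_likelihood_ratio exp_sum prod_ennreal lessThan_atLeast0)
  also have "\<dots> = (\<Prod>i\<in>{0..<n}. \<integral>\<^sup>+y. ennreal (?F i y) \<partial>law (et \<beta>s i))"
    unfolding data_eq by (rule product_nn_integral_prod) auto
  also have "\<dots> = 1"
  proof (rule prod.neutral, rule ballI)
    fix i
    have "(\<integral>\<^sup>+y. ennreal (?F i y) \<partial>law (et \<beta>s i)) = (\<integral>\<^sup>+y. ennreal (dens (et \<beta>s i) y) * ennreal (?F i y) \<partial>\<mu>)"
      unfolding law_def by (rule nn_integral_density) auto
    also have "\<dots> = (\<integral>\<^sup>+y. ennreal (dens (et \<beta> i) y) \<partial>\<mu>)"
    proof (rule nn_integral_cong)
      fix y
      show "ennreal (dens (et \<beta>s i) y) * ennreal (?F i y) = ennreal (dens (et \<beta> i) y)"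
        using dens_shift[of "et \<beta> i - et \<beta>s i" y "et \<beta>s i"] dens_nonneg
        by (simp add: ennreal_mult'[symmetric] mult.commute)
    qed
    also have "\<dots> = 1" by (simp add: nn_integral_dens)
    finally show "(\<integral>\<^sup>+y. ennreal (?F i y) \<partial>law (et \<beta>s i)) = 1" .
  qed
  finally show ?thesis .
qed

text \<open>Measurability in data and coefficients together prepares Tonelli's theorem in
  \<open>nn_integral_tilted_le\<close>.\<close>

lemma L_measurable_joint:
  assumes "S \<subseteq> {0..<d}"
  shows "(\<lambda>(Y, f). L \<beta>s Y (restr S f))
    \<in> borel_measurable (PiM {0..<n} (\<lambda>_. borel) \<Otimes>\<^sub>M PiM S (\<lambda>_. lborel))"
proof -
  let ?M = "PiM {0..<n} (\<lambda>_. borel) \<Otimes>\<^sub>M PiM S (\<lambda>_. lborel) :: ((nat \<Rightarrow> real) \<times> (nat \<Rightarrow> real)) measure"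
  have [measurable]: "\<eta> \<in> borel_measurable borel"
    by (intro borel_measurable_continuous_onI lipschitz_on_continuous_on[OF lip])
  \<comment> \<open>Regularity of \<open>A\<close> is known on \<open>range \<eta>\<close> only, so
    the Borel function to work with is its composition with \<open>\<eta>\<close>.\<close>
  have "continuous_on (range \<eta>) A"
    using A_deriv by (meson DERIV_isCont continuous_at_imp_continuous_on)
  then have [measurable]: "(\<lambda>x. A (\<eta> x)) \<in> borel_measurable borel"
    by (intro borel_measurable_continuous_onI continuous_on_compose2[OF _ lipschitz_on_continuous_on[OF lip]]) auto
  have lin [measurable]: "(\<lambda>p. \<Sum>j<d. X i j * restr S (snd p) j) \<in> borel_measurable ?M" for i
  proof (rule borel_measurable_sum)
    fix j
    have "(\<lambda>p. restr S (snd p) j) \<in> borel_measurable ?M"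
    proof (cases "j \<in> S")
      case True
      have "(\<lambda>f. f j) \<in> PiM S (\<lambda>_. lborel) \<rightarrow>\<^sub>M lborel"
        using True by (rule measurable_component_singleton)
      then have "(\<lambda>p. snd p j) \<in> ?M \<rightarrow>\<^sub>M lborel"
        by (rule measurable_compose[OF measurable_snd])
      then show ?thesis using True by (simp add: restr_def)
    qed (simp add: restr_def)
    then show "(\<lambda>p. X i j * restr S (snd p) j) \<in> borel_measurable ?M" by simp
  qed
  have T [measurable]: "(\<lambda>p. T (fst p i)) \<in> borel_measurable ?M" if "i < n" for i
  proof -
    have "(\<lambda>f. f i) \<in> PiM {0..<n} (\<lambda>_. borel) \<rightarrow>\<^sub>M borel"
      using that by (intro measurable_component_singleton) auto
    then have "(\<lambda>p. fst p i) \<in> ?M \<rightarrow>\<^sub>M borel"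
      by (rule measurable_compose[OF measurable_fst])
    then show ?thesis by measurable
  qed
  show ?thesis
    unfolding L_likelihood_ratio split_beta' etas_def
    by (intro borel_measurable_sum borel_measurable_diff borel_measurable_times T borel_measurable_const
       measurable_compose[OF lin, of \<eta> borel] measurable_compose[OF lin, of "\<lambda>x. A (\<eta> x)" borel]) auto
qed

lemma T_component_measurable [measurable]:
  assumes "i < n"
  shows "(\<lambda>Y. T (Y i)) \<in> borel_measurable (PiM {0..<n} (\<lambda>_. borel))"
  using assms by (intro measurable_compose[OF measurable_component_singleton[of i "{0..<n}" "\<lambda>_. borel"] T_meas]) auto

lemma L_measurable [measurable]: "(\<lambda>Y. L \<beta>s Y \<beta>) \<in> borel_measurable (PiM {0..<n} (\<lambda>_. borel))"
  unfolding L_likelihood_ratio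
  by (intro borel_measurable_sum borel_measurable_diff borel_measurable_times borel_measurable_const
      T_component_measurable) auto

lemma W_measurable [measurable]: "W \<beta>s \<in> borel_measurable (PiM {0..<n} (\<lambda>_. borel))"
  unfolding W_def
  by (intro borel_measurable_sum borel_measurable_diff borel_measurable_abs borel_measurable_const
      T_component_measurable) auto

text \<open>By convexity \<open>exp (c * x)\<close> lies below the chord
  \<open>(1 - c) + c * exp x\<close>, which has expectation one at \<open>x = L\<close>.\<close>

lemma nn_integral_exp_cL:
  assumes "0 \<le> c" "c \<le> 1"
  shows "(\<integral>\<^sup>+Y. ennreal (exp (c * L \<beta>s Y \<beta>)) \<partial>(data \<beta>s)) \<le> 1"
proof -
  interpret prob_space "data \<beta>s" by (rule prob_space_data)
  have "exp (c * x) \<le> (1 - c) + c * exp x" for x :: real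
    using convex_onD[OF exp_convex, of c 0 x] assms by simp
  then have "(\<integral>\<^sup>+Y. ennreal (exp (c * L \<beta>s Y \<beta>)) \<partial>(data \<beta>s))
      \<le> (\<integral>\<^sup>+Y. ennreal (1 - c) + ennreal c * ennreal (exp (L \<beta>s Y \<beta>)) \<partial>(data \<beta>s))"
    using assms by (intro nn_integral_mono) (simp add: ennreal_leI flip: ennreal_plus ennreal_mult')
  also have "\<dots> = ennreal (1 - c) + ennreal c"
    by (subst nn_integral_add) (auto simp: nn_integral_cmult nn_integral_exp_L emeasure_space_1)
  also have "\<dots> = 1" using assms by (simp flip: ennreal_plus)
  finally show ?thesis .
qed

lemma nn_integral_W_le: "(\<integral>\<^sup>+Y. ennreal (W \<beta>s Y) \<partial>(data \<beta>s)) \<le> ennreal (n * (1 + 4 * m))"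
proof -
  have "(\<integral>\<^sup>+Y. ennreal (W \<beta>s Y) \<partial>(data \<beta>s))
      = (\<integral>\<^sup>+Y. (\<Sum>i<n. ennreal \<bar>T (Y i) - A1 (et \<beta>s i)\<bar>) \<partial>(data \<beta>s))"
    by (simp add: W_def sum_ennreal)
  also have "\<dots> = (\<Sum>i<n. \<integral>\<^sup>+Y. ennreal \<bar>T (Y i) - A1 (et \<beta>s i)\<bar> \<partial>(data \<beta>s))"
    by (intro nn_integral_sum) auto
  also have "\<dots> \<le> (\<Sum>i<n. ennreal (1 + 4 * m))"
  proof (rule sum_mono)
    fix i assume i: "i \<in> {..<n}"
    have "(\<integral>\<^sup>+Y. ennreal \<bar>T (Y i) - A1 (et \<beta>s i)\<bar> \<partial>(data \<beta>s))
        = (\<integral>\<^sup>+y. ennreal \<bar>T y - A1 (et \<beta>s i)\<bar> \<partial>(distr (data \<beta>s) (law (et \<beta>s i)) (\<lambda>Y. Y i)))"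
      using i unfolding data_eq by (subst nn_integral_distr) auto
    also have "distr (data \<beta>s) (law (et \<beta>s i)) (\<lambda>Y. Y i) = law (et \<beta>s i)"
      using i unfolding data_eq by (intro distr_PiM_component prob_space_law et_in) auto
    also have "(\<integral>\<^sup>+y. ennreal \<bar>T y - A1 (et \<beta>s i)\<bar> \<partial>(law (et \<beta>s i))) \<le> ennreal (1 + 4 * m)"
      by (simp add: mean_abs_deviation)
    finally show "(\<integral>\<^sup>+Y. ennreal \<bar>T (Y i) - A1 (et \<beta>s i)\<bar> \<partial>(data \<beta>s)) \<le> ennreal (1 + 4 * m)" .
  qed
  also have "\<dots> = ennreal (n * (1 + 4 * m))"
    using m_ge_0 by (simp add: ennreal_mult' ennreal_of_nat_eq_real_of_nat)
  finally show ?thesis .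
qed

text \<open>Markov's inequality. The slack \<open>g\<close> makes the exceptional event vanish
  asymptotically while \<open>C\<close> stays fixed.\<close>

lemma W_tail:
  fixes C g :: real
  assumes "1 + 4 * m \<le> C" "0 < g" "0 < n"
  shows "emeasure (data \<beta>s) {Y \<in> space (data \<beta>s). n * C * g < W \<beta>s Y} \<le> ennreal (1 / g)"
proof -
  define t where "t = n * C * g"
  have t: "0 < t" using assms m_ge_0 by (simp add: t_def)
  have meas: "{Y \<in> space (data \<beta>s). t < W \<beta>s Y} \<in> sets (data \<beta>s)" by measurable
  have "emeasure (data \<beta>s) {Y \<in> space (data \<beta>s). t < W \<beta>s Y}
      = (\<integral>\<^sup>+Y. indicator {Y \<in> space (data \<beta>s). t < W \<beta>s Y} Y \<partial>(data \<beta>s))"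
    by (rule nn_integral_indicator[OF meas, symmetric])
  also have "\<dots> \<le> (\<integral>\<^sup>+Y. ennreal (1 / t) * ennreal (W \<beta>s Y) \<partial>(data \<beta>s))"
    using t by (intro nn_integral_mono)
      (auto simp: indicator_def ennreal_mult[symmetric] W_def sum_nonneg field_simps simp flip: ennreal_1 intro!: ennreal_leI)
  also have "\<dots> = ennreal (1 / t) * (\<integral>\<^sup>+Y. ennreal (W \<beta>s Y) \<partial>(data \<beta>s))"
    by (rule nn_integral_cmult) auto
  also have "\<dots> \<le> ennreal (1 / t) * ennreal (n * (1 + 4 * m))"
    by (intro mult_left_mono nn_integral_W_le) auto
  also have "\<dots> = ennreal (1 / t * (n * (1 + 4 * m)))"
    using t m_ge_0 by (intro ennreal_mult[symmetric]) auto
  also have "\<dots> \<le> ennreal (1 / g)"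
  proof (rule ennreal_leI)
    have "1 / t * (n * (1 + 4 * m)) = (1 + 4 * m) / (C * g)"
      using assms by (simp add: t_def)
    also have "\<dots> \<le> C / (C * g)"
      using assms m_ge_0 by (intro divide_right_mono) auto
    finally show "1 / t * (n * (1 + 4 * m)) \<le> 1 / g"
      using assms m_ge_0 by simp
  qed
  finally show ?thesis by (simp add: t_def)
qed

end

subsection \<open>Posterior bound for a fixed sample size\<close>

lemma quadratic_le_discriminant:
  fixes p q x :: real
  assumes "0 < q"
  shows "p * x - q * x\<^sup>2 \<le> p\<^sup>2 / (4 * q)"
  using zero_le_power2[of "2 * q * x - p"] assms
  by (simp add: field_simps power2_eq_square)

text \<open>\<open>Mc\<close> stands for \<open>M1 M0\<close>, so that \<open>nX * Mc\<close> is the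
  constant in the threshold; \<open>g\<close> is the slack in Markov's inequality.
  \<open>noise_small\<close> and \<open>drift_small\<close> compare model constants with
  \<open>ln d\<close> and hold for large samples once \<open>g\<close> is the fourth root of
  \<open>ln d\<close>.\<close>

locale sparse_truth = clipped_glm \<mu> h T A A1 A2 \<eta> m K nX n d X
  for \<mu> :: "real measure" and h T A A1 A2 \<eta> :: "real \<Rightarrow> real" and m K nX :: real
    and n d :: nat and X :: "nat \<Rightarrow> nat \<Rightarrow> real" +
  fixes Mc C g a lam \<phi> :: real and \<beta>s :: "nat \<Rightarrow> real"
  assumes n_pos: "0 < n" and n_less_d: "n < d" and nX_pos: "0 < nX" and K_ge_1: "1 \<le> K"
    and Mc_ge_1: "1 \<le> Mc" and C_ge: "1 + 4 * m \<le> C" "Mc \<le> C" and g_ge_1: "1 \<le> g" and a_gt_1: "1 < a"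
    and lam_ge: "nX * Mc / d \<le> lam" and lam_le: "lam \<le> nX * Mc * sqrt (ln d)"
    and ln_d_ge: "2 \<le> ln d" and ln_d_le: "ln d \<le> n"
    and truth_in: "\<beta>s \<in> Rd d" and supp_pos: "0 < card (supp \<beta>s)" and phi_pos: "0 < \<phi>"
    and compat: "\<And>\<beta>. \<beta> \<in> Rd d \<Longrightarrow> restr (supp \<beta>s) \<beta>s \<noteq> restr (supp \<beta>s) \<beta> \<Longrightarrow>
        l1norm ({0..<d} - supp \<beta>s) (\<beta> - \<beta>s) < 7 * l1norm (supp \<beta>s) (\<beta> - \<beta>s) \<Longrightarrow>
        n * \<phi>\<^sup>2 / card (supp \<beta>s) * (l1norm (supp \<beta>s) (\<beta> - \<beta>s))\<^sup>2 \<le> Dn A A1 n (et \<beta>s) (et \<beta>)"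
    and noise_small: "K * C * g + m * K\<^sup>2 + Mc \<le> ln d"
    and drift_small: "9 / 4 * K * C * g * sqrt (ln d) \<le> ln d"
begin

abbreviation s :: real where "s \<equiv> real (card (supp \<beta>s))"

text \<open>On the event \<open>W \<beta>s Y \<le> n * C * g\<close> the noise is at most
  \<open>lbar\<close> per unit of distance from the truth. \<open>\<gamma>\<close> solves
  \<open>\<gamma> * lbar = lam / 4\<close>, and \<open>Q\<close> is the price of recentring the
  penalty at the truth, which the threshold has to outweigh.\<close>

definition lbar where "lbar = K * nX * n * C * g"
definition \<gamma> where "\<gamma> = lam / (4 * lbar)"
definition Q where "Q = s * ln d * ((nX * Mc)\<^sup>2 / \<phi>\<^sup>2)"

lemma supp_sub: "supp \<beta>s \<subseteq> {0..<d}"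
  using truth_in by (auto simp: supp_def Rd_def not_le)

lemma finite_supp: "finite (supp \<beta>s)"
  using supp_sub finite_subset by blast

lemma C_pos: "1 \<le> C" using C_ge Mc_ge_1 by linarith

lemma lam_pos: "0 < lam"
proof -
  have "0 < nX * Mc / d" using nX_pos Mc_ge_1 n_less_d by simp
  then show ?thesis using lam_ge by linarith
qed

lemma lbar_pos: "0 < lbar"
  using K_ge_1 nX_pos n_pos C_pos g_ge_1 by (simp add: lbar_def)

lemma sqrt_ln_d_le: "sqrt (ln d) \<le> ln d"
proof -
  have "sqrt (ln d) * 1 \<le> sqrt (ln d) * sqrt (ln d)"
    using ln_d_ge by (intro mult_left_mono) auto
  then show ?thesis using ln_d_ge by simp
qed

lemma gamma_bounds: "0 < \<gamma>" "\<gamma> \<le> 1"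
proof -
  show "0 < \<gamma>" using lam_pos lbar_pos by (simp add: \<gamma>_def)
  have "lam \<le> nX * Mc * n"
    using lam_le sqrt_ln_d_le ln_d_le nX_pos Mc_ge_1
    by (smt (verit) mult_left_mono mult_pos_pos)
  also have "\<dots> \<le> nX * C * n" using C_ge nX_pos by (simp add: mult_right_mono)
  also have "\<dots> = 1 * (nX * C * n) * 1" by simp
  also have "\<dots> \<le> K * (nX * C * n) * g"
    using K_ge_1 g_ge_1 nX_pos C_pos by (intro mult_mono) auto
  also have "\<dots> = lbar" by (simp add: lbar_def)
  finally show "\<gamma> \<le> 1" using lbar_pos by (simp add: \<gamma>_def)
qed

lemma Q_nonneg: "0 \<le> Q"
  using ln_d_ge by (simp add: Q_def)

text \<open>The left side is the maximum of the quadratic met in \<open>penalised_L_le\<close>. The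
  upper bound on \<open>lam\<close> supplies \<open>sqrt (ln d)\<close>, \<open>drift_small\<close>
  absorbs the other factors, and \<open>1 \<le> Mc\<close> allows a second factor
  \<open>Mc\<close>.\<close>

lemma drift_bound: "9 / 4 * lam * s * (K * nX * C * g) / \<phi>\<^sup>2 \<le> Q"
proof -
  have "9 / 4 * lam * (K * nX * C * g) \<le> 9 / 4 * (nX * Mc * sqrt (ln d)) * (K * nX * C * g)"
    using lam_le K_ge_1 nX_pos C_pos g_ge_1 by (intro mult_right_mono) auto
  also have "\<dots> = nX\<^sup>2 * Mc * (9 / 4 * K * C * g * sqrt (ln d))"
    by (simp add: power2_eq_square algebra_simps)
  also have "\<dots> \<le> nX\<^sup>2 * Mc * ln d"
    using drift_small Mc_ge_1 by (intro mult_left_mono) auto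
  also have "\<dots> \<le> nX\<^sup>2 * (Mc * Mc) * ln d"
    using Mc_ge_1 ln_d_ge by (intro mult_right_mono mult_left_mono) auto
  finally have "9 / 4 * lam * (K * nX * C * g) \<le> (nX * Mc)\<^sup>2 * ln d"
    by (simp add: power2_eq_square algebra_simps)
  then have "9 / 4 * lam * (K * nX * C * g) * (s / \<phi>\<^sup>2) \<le> (nX * Mc)\<^sup>2 * ln d * (s / \<phi>\<^sup>2)"
    by (rule mult_right_mono) auto
  then show ?thesis by (simp add: Q_def algebra_simps)
qed

lemma l1_split: "l1 v = l1norm (supp \<beta>s) v + l1norm ({0..<d} - supp \<beta>s) v"
  unfolding l1norm_def using sum.subset_diff[OF supp_sub, of "\<lambda>j. \<bar>v j\<bar>"] by simp

text \<open>The truth vanishes off its support, so there any deviation is pure penalty; on the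
  support the triangle inequality applies.\<close>

lemma l1_decomposition:
  "l1 \<beta>s - l1 \<beta> \<le> l1norm (supp \<beta>s) (\<beta> - \<beta>s) - l1norm ({0..<d} - supp \<beta>s) (\<beta> - \<beta>s)"
proof -
  have off: "l1norm ({0..<d} - supp \<beta>s) \<beta>s = 0"
      "l1norm ({0..<d} - supp \<beta>s) (\<beta> - \<beta>s) = l1norm ({0..<d} - supp \<beta>s) \<beta>"
    unfolding l1norm_def by (auto intro!: sum.neutral sum.cong simp: supp_def)
  have "l1norm (supp \<beta>s) \<beta>s \<le> l1norm (supp \<beta>s) \<beta> + l1norm (supp \<beta>s) (\<beta> - \<beta>s)"
    unfolding l1norm_def sum.distrib[symmetric] by (rule sum_mono) auto
  then show ?thesis unfolding l1_split using off by simp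
qed

text \<open>The log-likelihood is split as \<open>(1 - \<gamma>) L + \<gamma> L\<close>: the first part has exponential moment at
  most one, while the second is bounded pathwise, its noise being absorbed by the \<open>\<ell>\<^sub>1\<close> penalty
  and its drift paying for the recentring of the penalty at the truth.\<close>

lemma penalised_L_le:
  assumes W: "W \<beta>s Y \<le> n * C * g" and \<beta>: "\<beta> \<in> Rd d"
  shows "L \<beta>s Y \<beta> - lam * l1 \<beta>
    \<le> (1 - \<gamma>) * L \<beta>s Y \<beta> - lam * l1 \<beta>s - lam / 4 * l1 (\<beta> - \<beta>s) + Q"
proof -
  define x y where "x = l1norm (supp \<beta>s) (\<beta> - \<beta>s)" and "y = l1norm ({0..<d} - supp \<beta>s) (\<beta> - \<beta>s)"
  define D where "D = Dn A A1 n (et \<beta>s) (et \<beta>)"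
  have xy: "0 \<le> x" "0 \<le> y" by (simp_all add: x_def y_def l1norm_nonneg)
  have l1v: "l1 (\<beta> - \<beta>s) = x + y" by (simp add: x_def y_def l1_split)
  have "L \<beta>s Y \<beta> + D \<le> K * nX * W \<beta>s Y * l1 (\<beta> - \<beta>s)"
    using L_plus_Dn_abs[of Y \<beta> \<beta>s] by (simp add: D_def)
  also have "\<dots> \<le> K * nX * (n * C * g) * l1 (\<beta> - \<beta>s)"
    using W K_ge_1 nX_pos by (intro mult_right_mono mult_left_mono) (auto simp: l1norm_nonneg)
  also have "\<dots> = lbar * (x + y)" by (simp add: lbar_def l1v)
  finally have "\<gamma> * (L \<beta>s Y \<beta> + D) \<le> \<gamma> * (lbar * (x + y))"
    using gamma_bounds by (intro mult_left_mono) auto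
  also have "\<dots> = lam / 4 * (x + y)" using lbar_pos by (simp add: \<gamma>_def)
  finally have gL: "\<gamma> * L \<beta>s Y \<beta> \<le> lam / 4 * (x + y) - \<gamma> * D" by (simp add: algebra_simps)
  have "lam * (l1 \<beta>s - l1 \<beta>) \<le> lam * (x - y)"
    using l1_decomposition[of \<beta>] lam_pos by (intro mult_left_mono) (auto simp: x_def y_def)
  then have "\<gamma> * L \<beta>s Y \<beta> + lam * (l1 \<beta>s - l1 \<beta>) + lam / 4 * (x + y)
      \<le> lam / 4 * (x + y) - \<gamma> * D + lam * (x - y) + lam / 4 * (x + y)"
    using gL by linarith
  \<comment> \<open>The two quarters come from the noise and from the distance kept for integration;
    the recentred penalty gives 1 for \<open>x\<close> and -1 for \<open>y\<close>.\<close>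
  also have "\<dots> = lam * (3 / 2 * x - 1 / 2 * y) - \<gamma> * D"
    by (simp add: algebra_simps)
  also have "\<dots> \<le> Q"
  \<comment> \<open>Outside the cone, \<open>y \<ge> 7 * x\<close> makes the penalty term
    nonpositive by itself. Inside, \<open>compat\<close> supplies a drift quadratic in
    \<open>x\<close> against a linear gain.\<close>
  proof (cases "y < 7 * x")
    case False
    have "0 \<le> \<gamma> * D" using gamma_bounds Dn_nonneg by (simp add: D_def)
    moreover have "lam * (3 / 2 * x - 1 / 2 * y) \<le> 0"
      using False xy lam_pos by (intro mult_nonneg_nonpos) auto
    ultimately show ?thesis using Q_nonneg by linarith
  next
    case True
    then have "0 < x" using xy by linarith
    have "restr (supp \<beta>s) \<beta>s \<noteq> restr (supp \<beta>s) \<beta>"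
    proof
      assume eq: "restr (supp \<beta>s) \<beta>s = restr (supp \<beta>s) \<beta>"
      have "\<beta>s j = \<beta> j" if "j \<in> supp \<beta>s" for j
        using fun_cong[OF eq, of j] that by (simp add: restr_def)
      then have "x = 0" by (simp add: x_def l1norm_def)
      with \<open>0 < x\<close> show False by simp
    qed
    then have "n * \<phi>\<^sup>2 / s * x\<^sup>2 \<le> D"
      using compat[OF \<beta>] True by (simp add: x_def y_def D_def)
    then have "\<gamma> * (n * \<phi>\<^sup>2 / s * x\<^sup>2) \<le> \<gamma> * D"
      using gamma_bounds by (intro mult_left_mono) auto
    moreover have "lam * (3 / 2 * x - 1 / 2 * y) \<le> lam * (3 / 2 * x)"
      using lam_pos xy by (intro mult_left_mono) auto
    moreover have "\<gamma> * (n * \<phi>\<^sup>2 / s * x\<^sup>2) = (\<gamma> * n * \<phi>\<^sup>2 / s) * x\<^sup>2" "lam * (3 / 2 * x) = (3 / 2 * lam) * x"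
      by simp_all
    ultimately have "lam * (3 / 2 * x - 1 / 2 * y) - \<gamma> * D \<le> (3 / 2 * lam) * x - (\<gamma> * n * \<phi>\<^sup>2 / s) * x\<^sup>2"
      by linarith
    \<comment> \<open>Maximizing over \<open>x\<close> removes the unknown distance; unfolding
      \<open>\<gamma>\<close> then cancels \<open>n\<close> and one factor
      \<open>lam\<close>.\<close>
    also have "\<dots> \<le> (3 / 2 * lam)\<^sup>2 / (4 * (\<gamma> * n * \<phi>\<^sup>2 / s))"
      using gamma_bounds n_pos phi_pos supp_pos by (intro quadratic_le_discriminant) simp
    also have "\<dots> = 9 / 4 * lam * s * (K * nX * C * g) / \<phi>\<^sup>2"
      using lam_pos K_ge_1 nX_pos n_pos C_pos g_ge_1 phi_pos supp_pos
      by (simp add: \<gamma>_def lbar_def field_simps power2_eq_square)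
    also have "\<dots> \<le> Q" by (rule drift_bound)
    finally show ?thesis .
  qed
  finally show ?thesis by (simp add: l1v algebra_simps)
qed

section \<open>Lower bound for the normalizer of the posterior\<close>

lemma exp_ln_d: "exp (ln d) = d"
  using n_less_d by simp

lemma prior_const_pos: "0 < prior_const a d"
  unfolding prior_const_def using n_less_d by (intro positive_imp_inverse_positive sum_pos) auto

lemma card_supp_le: "card (supp \<beta>s) \<le> d"
  using card_mono[OF _ supp_sub] by simp

text \<open>On this small cube the penalty loses at most \<open>Mc * s\<close>, the noise
  \<open>K * C * g * s\<close> and the drift \<open>m * K\<^sup>2 * s\<close>. By
  \<open>noise_small\<close> these add up to at most \<open>s * ln d\<close>.\<close>

lemma L_near_truth:
  assumes W: "W \<beta>s Y \<le> n * C * g" and f: "\<And>j. j \<in> supp \<beta>s \<Longrightarrow> \<bar>f j - \<beta>s j\<bar> \<le> 1 / (nX * d)"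
  shows "- lam * l1 \<beta>s - s * ln d \<le> - lam * l1norm (supp \<beta>s) f + L \<beta>s Y (restr (supp \<beta>s) f)"
proof -
  let ?\<beta> = "restr (supp \<beta>s) f"
  define \<rho> where "\<rho> = l1 (?\<beta> - \<beta>s)"
  have d: "0 < d" using n_less_d by simp
  have "\<rho> = l1norm (supp \<beta>s) (\<lambda>j. f j - \<beta>s j)"
    unfolding \<rho>_def l1norm_def
    by (rule sum.mono_neutral_cong_right) (use supp_sub in \<open>auto simp: restr_def supp_def\<close>)
  also have "\<dots> \<le> (\<Sum>j\<in>supp \<beta>s. 1 / (nX * d))"
    unfolding l1norm_def by (rule sum_mono) (rule f)
  finally have "\<rho> \<le> s / (nX * d)" by simp
  then have \<rho>: "nX * \<rho> \<le> s / d" "0 \<le> \<rho>"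
    using nX_pos d by (auto simp: field_simps \<rho>_def l1norm_nonneg)
  have "l1 ?\<beta> = l1norm (supp \<beta>s) f" by (rule l1norm_restr) (auto simp: supp_sub)
  moreover have "l1 ?\<beta> \<le> l1 \<beta>s + \<rho>"
    unfolding \<rho>_def l1norm_def sum.distrib[symmetric] by (rule sum_mono) auto
  ultimately have "lam * l1norm (supp \<beta>s) f \<le> lam * l1 \<beta>s + lam * \<rho>"
    using lam_pos by (metis distrib_left less_imp_le mult_left_mono)
  moreover have "lam * \<rho> \<le> Mc * s"
  proof -
    have "lam * \<rho> \<le> nX * Mc * sqrt (ln d) * \<rho>" using lam_le \<rho> by (intro mult_right_mono) auto
    also have "\<dots> = Mc * sqrt (ln d) * (nX * \<rho>)" by simp
    also have "\<dots> \<le> Mc * d * (s / d)"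
    proof (intro mult_mono mult_left_mono)
      show "sqrt (ln d) \<le> d" using sqrt_ln_d_le ln_d_le n_less_d by linarith
    qed (use Mc_ge_1 \<rho> nX_pos ln_d_ge in auto)
    finally show ?thesis using d by simp
  qed
  moreover have "K * nX * W \<beta>s Y * \<rho> \<le> K * C * g * s"
  proof -
    have "K * nX * W \<beta>s Y * \<rho> \<le> K * nX * (d * C * g) * \<rho>"
    proof (intro mult_right_mono mult_left_mono)
      have "n * C * g \<le> d * C * g"
        using n_less_d C_pos g_ge_1 by (intro mult_right_mono) auto
      then show "W \<beta>s Y \<le> d * C * g" using W by linarith
    qed (use K_ge_1 nX_pos \<rho> in auto)
    also have "\<dots> = (K * C * g * d) * (nX * \<rho>)" by simp
    also have "\<dots> \<le> (K * C * g * d) * (s / d)"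
      using \<rho> K_ge_1 C_pos g_ge_1 by (intro mult_left_mono) auto
    finally show ?thesis using d by simp
  qed
  moreover have "n * m * (K * nX * \<rho>)\<^sup>2 \<le> m * K\<^sup>2 * s"
  proof -
    have "(nX * \<rho>)\<^sup>2 \<le> (s / d)\<^sup>2" using \<rho> nX_pos by (intro power_mono) auto
    also have "\<dots> = (s / d) * (s / d)" by (simp add: power2_eq_square)
    \<comment> \<open>One of the two factors is at most 1 because the support has at most
      \<open>d\<close> elements; the other keeps the \<open>1 / d\<close> that compensates
      \<open>n\<close>.\<close>
    also have "\<dots> \<le> 1 * (s / d)"
      using d card_supp_le by (intro mult_right_mono) auto
    finally have "n * (nX * \<rho>)\<^sup>2 \<le> d * (s / d)"
      using n_less_d by (intro mult_mono) auto
    then have "m * K\<^sup>2 * (n * (nX * \<rho>)\<^sup>2) \<le> m * K\<^sup>2 * s"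
      using m_ge_0 d by (intro mult_left_mono) auto
    then show ?thesis by (simp add: power_mult_distrib algebra_simps)
  qed
  moreover have "- (K * nX * W \<beta>s Y * \<rho>) - n * m * (K * nX * \<rho>)\<^sup>2 \<le> L \<beta>s Y ?\<beta>"
    using L_plus_Dn_abs[of Y ?\<beta> \<beta>s] Dn_le[of \<beta>s ?\<beta>] unfolding \<rho>_def by linarith
  moreover have "s * (K * C * g + m * K\<^sup>2 + Mc) \<le> s * ln d"
    using noise_small by (intro mult_left_mono) auto
  ultimately show ?thesis by (simp add: algebra_simps)
qed

text \<open>Each true coordinate costs \<open>a + 4\<close> powers of \<open>d\<close>:
  \<open>a\<close> from the prior and one each from the binomial coefficient, the lower bound on
  \<open>lam\<close>, the side of the cube and the loss in \<open>L_near_truth\<close>.\<close>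

definition den :: real where
  "den = prior_const a d * (exp (- lam * l1 \<beta>s) * exp (- ((a + 4) * s * ln d)))"

lemma den_pos: "0 < den"
  using prior_const_pos by (simp add: den_def)

text \<open>The scale \<open>nX\<close> cancels: \<open>lam\<close> is at least
  \<open>nX / d\<close>, while the cube has side \<open>2 / (nX * d)\<close>.\<close>

lemma slab_weight_ge:
  "exp (- (a + 3) * s * ln d)
    \<le> inverse (real (d choose card (supp \<beta>s))) * (lam / (2 * real d powr a)) ^ card (supp \<beta>s)
      * (2 / (nX * d)) ^ card (supp \<beta>s)"
proof -
  let ?k = "card (supp \<beta>s)"
  have d: "0 < d" using n_less_d by simp
  have "exp (- (s * ln d)) \<le> inverse (real (d choose ?k))"
  proof -
    have "real (d choose ?k) \<le> real (d ^ ?k)"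
      using binomial_le_pow[OF card_supp_le] of_nat_mono by blast
    also have "\<dots> = exp (s * ln d)" using exp_of_nat_mult[of ?k "ln d"] exp_ln_d by simp
    finally show ?thesis using card_supp_le
      by (simp add: exp_minus le_imp_inverse_le)
  qed
  moreover have "exp (- (a + 2) * s * ln d) \<le> (lam / (2 * real d powr a)) ^ ?k * (2 / (nX * d)) ^ ?k"
  proof -
    have "exp (- (a + 2) * ln d) = (1 / d * (1 / d)) / real d powr a"
    proof -
      have "exp (- (a + 2) * ln d) = exp (- ln d) * exp (- ln d) * exp (- (a * ln d))"
        by (simp add: algebra_simps flip: exp_add)
      also have "\<dots> = (1 / d * (1 / d)) / real d powr a"
        using d unfolding exp_minus exp_ln_d by (simp add: powr_def divide_inverse)
      finally show ?thesis .
    qed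
    also have "\<dots> \<le> (lam / nX * (1 / d)) / real d powr a"
    proof (intro divide_right_mono mult_right_mono)
      have "nX * 1 / d \<le> nX * Mc / d"
        using Mc_ge_1 nX_pos by (intro divide_right_mono mult_left_mono) auto
      then show "1 / d \<le> lam / nX"
        using lam_ge nX_pos by (simp add: field_simps)
    qed auto
    also have "\<dots> = lam / (2 * real d powr a) * (2 / (nX * d))" using d nX_pos by simp
    finally have "exp (- (a + 2) * ln d) ^ ?k \<le> (lam / (2 * real d powr a) * (2 / (nX * d))) ^ ?k"
      by (intro power_mono) auto
    moreover have "exp (- (a + 2) * ln d) ^ ?k = exp (- (a + 2) * s * ln d)"
      by (simp add: algebra_simps flip: exp_of_nat_mult)
    ultimately show ?thesis
      unfolding power_mult_distrib by (simp only:)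
  qed
  ultimately have "exp (- (s * ln d)) * exp (- (a + 2) * s * ln d)
    \<le> inverse (real (d choose ?k)) * ((lam / (2 * real d powr a)) ^ ?k * (2 / (nX * d)) ^ ?k)"
    by (intro mult_mono) auto
  then show ?thesis
    by (simp add: algebra_simps flip: exp_add)
qed

lemma denominator_ge:
  assumes W: "W \<beta>s Y \<le> n * C * g"
  shows "ennreal den \<le> prior_integral a lam d (\<lambda>\<beta>. exp (L \<beta>s Y \<beta>))"
proof -
  let ?S = "supp \<beta>s" and ?k = "card (supp \<beta>s)"
  interpret product_sigma_finite "\<lambda>_ :: nat. lborel :: real measure" ..
  define r where "r = 1 / (nX * d)"
  have r: "0 < r" using nX_pos n_less_d by (simp add: r_def)
  define B where "B = PiE ?S (\<lambda>j. {\<beta>s j - r .. \<beta>s j + r})"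
  have emB: "emeasure (PiM ?S (\<lambda>_. lborel)) B = ennreal ((2 * r) ^ ?k)"
    unfolding B_def using r finite_supp by (subst emeasure_PiM) (auto simp: prod_ennreal ennreal_power)
  have Bm: "B \<in> sets (PiM ?S (\<lambda>_. lborel))"
    unfolding B_def using finite_supp by (intro sets_PiM_I_finite) auto
  define e where "e = exp (- lam * l1 \<beta>s - s * ln d)"
  define w where "w = prior_const a d * inverse (real (d choose ?k)) * (lam / (2 * real d powr a)) ^ ?k"
  have w0: "0 \<le> w" using prior_const_pos lam_pos by (simp add: w_def)
  have "ennreal den \<le> ennreal (w * (e * (2 * r) ^ ?k))"
  proof (rule ennreal_leI)
    have "den = prior_const a d * e * exp (- (a + 3) * s * ln d)"
      by (simp add: den_def e_def algebra_simps flip: exp_add)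
    also have "\<dots> \<le> prior_const a d * e * (inverse (real (d choose ?k))
        * (lam / (2 * real d powr a)) ^ ?k * (2 / (nX * d)) ^ ?k)"
      using prior_const_pos by (intro mult_left_mono slab_weight_ge) (auto simp: e_def)
    finally show "den \<le> w * (e * (2 * r) ^ ?k)"
      by (simp add: w_def r_def algebra_simps)
  qed
  also have "\<dots> = ennreal w * (\<integral>\<^sup>+f. ennreal e * indicator B f \<partial>PiM ?S (\<lambda>_. lborel))"
    using Bm emB w0 r by (simp add: nn_integral_cmult_indicator ennreal_mult e_def)
  also have "\<dots> \<le> ennreal w * (\<integral>\<^sup>+f. ennreal (exp (- lam * l1norm ?S f) * exp (L \<beta>s Y (restr ?S f))) \<partial>PiM ?S (\<lambda>_. lborel))"
  proof (intro mult_left_mono nn_integral_mono)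
    fix f
    show "ennreal e * indicator B f \<le> ennreal (exp (- lam * l1norm ?S f) * exp (L \<beta>s Y (restr ?S f)))"
    proof (cases "f \<in> B")
      case True
      then have "\<bar>f j - \<beta>s j\<bar> \<le> 1 / (nX * d)" if "j \<in> ?S" for j
        using that by (auto simp: B_def PiE_iff r_def[symmetric] abs_le_iff)
      from L_near_truth[OF W this] have "e \<le> exp (- lam * l1norm ?S f + L \<beta>s Y (restr ?S f))"
        by (simp add: e_def)
      then show ?thesis using True unfolding exp_add by (simp add: ennreal_leI)
    qed simp
  qed auto
  \<comment> \<open>All models contribute nonnegatively, so the true one alone bounds the normalizer
    from below.\<close>
  also have "\<dots> \<le> prior_integral a lam d (\<lambda>\<beta>. exp (L \<beta>s Y \<beta>))"
    unfolding prior_integral_def w_def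
    by (rule member_le_sum[where f = "\<lambda>S. ennreal (prior_const a d * inverse (real (d choose card S)) * (lam / (2 * real d powr a)) ^ card S)
        * (\<integral>\<^sup>+ f. ennreal (exp (- lam * l1norm S f) * exp (L \<beta>s Y (restr S f))) \<partial>(PiM S (\<lambda>_. lborel)))"])
      (use supp_sub in auto)
  finally show ?thesis .
qed

section \<open>Upper bound for the numerator of the posterior\<close>

definition slab_dist :: "nat set \<Rightarrow> (nat \<Rightarrow> real) \<Rightarrow> real" where
  "slab_dist S f = exp (- (lam / 4) * (\<Sum>j\<in>S. \<bar>f j - \<beta>s j\<bar>))"

text \<open>The majorant of one model's slab integral that results from
  \<open>penalised_L_le\<close>: only the share \<open>1 - \<gamma>\<close> of the log-likelihood
  stays random, and a Laplace factor centred at the truth makes it integrable.\<close>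

definition tilted :: "nat set \<Rightarrow> (nat \<Rightarrow> real) \<Rightarrow> ennreal" where
  "tilted S Y = (\<integral>\<^sup>+f. ennreal (exp (Q - lam * l1 \<beta>s) * slab_dist S f)
      * ennreal (exp ((1 - \<gamma>) * L \<beta>s Y (restr S f))) \<partial>PiM S (\<lambda>_. lborel))"

lemma sigma_finite_PiM_lborel:
  "finite S \<Longrightarrow> sigma_finite_measure (PiM S (\<lambda>_ :: nat. lborel :: real measure))"
  by (intro product_sigma_finite.sigma_finite) (unfold_locales, auto)

lemma slab_dist_measurable [measurable]: "slab_dist S \<in> borel_measurable (PiM S (\<lambda>_. lborel))"
proof -
  have "(\<lambda>f. f j) \<in> borel_measurable (PiM S (\<lambda>_. lborel :: real measure))" if "j \<in> S" for j
    using measurable_component_singleton[OF that, of "\<lambda>_. lborel :: real measure"] by simp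
  then show ?thesis
    unfolding slab_dist_def
    by (intro measurable_compose[OF _ borel_measurable_exp] borel_measurable_times borel_measurable_sum
        borel_measurable_abs borel_measurable_diff borel_measurable_const) auto
qed

lemma tilted_integrand_measurable:
  assumes "S \<subseteq> {0..<d}"
  shows "(\<lambda>(Y, f). ennreal (exp (Q - lam * l1 \<beta>s) * slab_dist S f)
      * ennreal (exp ((1 - \<gamma>) * L \<beta>s Y (restr S f)))) \<in> borel_measurable (data \<beta>s \<Otimes>\<^sub>M PiM S (\<lambda>_. lborel))"
proof -
  have "sets (data \<beta>s \<Otimes>\<^sub>M PiM S (\<lambda>_. lborel :: real measure))
      = sets (PiM {0..<n} (\<lambda>_. borel) \<Otimes>\<^sub>M PiM S (\<lambda>_. lborel))"
    by (intro sets_pair_measure_cong) auto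
  then have [measurable]: "(\<lambda>p. L \<beta>s (fst p) (restr S (snd p)))
      \<in> borel_measurable (data \<beta>s \<Otimes>\<^sub>M PiM S (\<lambda>_. lborel))"
    using L_measurable_joint[OF assms, of \<beta>s] by (simp add: split_beta' cong: measurable_cong_sets)
  show ?thesis unfolding split_beta' by measurable
qed

lemma tilted_measurable:
  assumes "S \<subseteq> {0..<d}"
  shows "tilted S \<in> borel_measurable (data \<beta>s)"
proof -
  interpret sigma_finite_measure "PiM S (\<lambda>_ :: nat. lborel :: real measure)"
    using assms finite_subset by (intro sigma_finite_PiM_lborel) blast
  show ?thesis
    unfolding tilted_def using tilted_integrand_measurable[OF assms] by (rule borel_measurable_nn_integral)
qed

text \<open>Each coordinate is a Laplace integral of rate \<open>lam / 4\<close>. Against the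
  \<open>lam / 2\<close> of the prior, its mass \<open>8 / lam\<close> leaves a factor 4 per
  coordinate.\<close>

lemma nn_integral_slab_dist:
  assumes "finite S"
  shows "(\<integral>\<^sup>+f. ennreal (slab_dist S f) \<partial>PiM S (\<lambda>_. lborel)) \<le> ennreal ((8 / lam) ^ card S)"
proof -
  interpret product_sigma_finite "\<lambda>_ :: nat. lborel :: real measure" ..
  have "(\<integral>\<^sup>+f. ennreal (slab_dist S f) \<partial>PiM S (\<lambda>_. lborel))
      = (\<integral>\<^sup>+f. (\<Prod>j\<in>S. ennreal (exp (- (lam / 4 * \<bar>f j - \<beta>s j\<bar>)))) \<partial>PiM S (\<lambda>_. lborel))"
    using assms by (simp add: slab_dist_def prod_ennreal exp_sum[symmetric] sum_distrib_left sum_negf)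
  also have "\<dots> = (\<Prod>j\<in>S. \<integral>\<^sup>+x. ennreal (exp (- (lam / 4 * \<bar>x - \<beta>s j\<bar>))) \<partial>lborel)"
    using assms by (rule product_nn_integral_prod) auto
  also have "\<dots> \<le> (\<Prod>j\<in>S. ennreal (8 / lam))"
    using nn_integral_laplace_le[of "lam / 4"] lam_pos by (intro prod_mono_ennreal) auto
  also have "\<dots> = ennreal ((8 / lam) ^ card S)"
    using lam_pos by (simp add: ennreal_power)
  finally show ?thesis .
qed

text \<open>By Tonelli the data are integrated first; their exponential moment is at most one for
  every \<open>f\<close>, and only the Laplace factor remains.\<close>

lemma nn_integral_tilted_le:
  assumes "S \<subseteq> {0..<d}"
  shows "(\<integral>\<^sup>+Y. tilted S Y \<partial>data \<beta>s) \<le> ennreal (exp (Q - lam * l1 \<beta>s) * (8 / lam) ^ card S)"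
proof -
  let ?k = "exp (Q - lam * l1 \<beta>s)"
  have fin: "finite S" using assms finite_subset by blast
  interpret D: prob_space "data \<beta>s" by (rule prob_space_data)
  interpret S: sigma_finite_measure "PiM S (\<lambda>_ :: nat. lborel :: real measure)"
    using fin by (rule sigma_finite_PiM_lborel)
  interpret pair_sigma_finite "data \<beta>s" "PiM S (\<lambda>_ :: nat. lborel :: real measure)" ..
  have "(\<integral>\<^sup>+Y. tilted S Y \<partial>data \<beta>s) = (\<integral>\<^sup>+f. (\<integral>\<^sup>+Y. ennreal (?k * slab_dist S f)
      * ennreal (exp ((1 - \<gamma>) * L \<beta>s Y (restr S f))) \<partial>data \<beta>s) \<partial>PiM S (\<lambda>_. lborel))"
    unfolding tilted_def by (rule Fubini'[OF tilted_integrand_measurable[OF assms], symmetric])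
  also have "\<dots> \<le> (\<integral>\<^sup>+f. ennreal ?k * ennreal (slab_dist S f) \<partial>PiM S (\<lambda>_. lborel))"
  proof (rule nn_integral_mono)
    fix f
    have "(\<integral>\<^sup>+Y. ennreal (?k * slab_dist S f) * ennreal (exp ((1 - \<gamma>) * L \<beta>s Y (restr S f))) \<partial>data \<beta>s)
        = ennreal (?k * slab_dist S f) * (\<integral>\<^sup>+Y. ennreal (exp ((1 - \<gamma>) * L \<beta>s Y (restr S f))) \<partial>data \<beta>s)"
      by (rule nn_integral_cmult) measurable
    also have "\<dots> \<le> ennreal (?k * slab_dist S f) * 1"
      using gamma_bounds by (intro mult_left_mono nn_integral_exp_cL) auto
    finally show "(\<integral>\<^sup>+Y. ennreal (?k * slab_dist S f) * ennreal (exp ((1 - \<gamma>) * L \<beta>s Y (restr S f))) \<partial>data \<beta>s)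
        \<le> ennreal ?k * ennreal (slab_dist S f)"
      by (simp add: ennreal_mult slab_dist_def)
  qed
  also have "\<dots> = ennreal ?k * (\<integral>\<^sup>+f. ennreal (slab_dist S f) \<partial>PiM S (\<lambda>_. lborel))"
    by (rule nn_integral_cmult) measurable
  also have "\<dots> \<le> ennreal ?k * ennreal ((8 / lam) ^ card S)"
    using fin by (intro mult_left_mono nn_integral_slab_dist) auto
  also have "\<dots> = ennreal (?k * (8 / lam) ^ card S)"
    using lam_pos by (intro ennreal_mult[symmetric]) auto
  finally show ?thesis .
qed

definition weight :: "nat set \<Rightarrow> real" where
  "weight S = prior_const a d * inverse (real (d choose card S)) * (lam / (2 * real d powr a)) ^ card S"

lemma weight_nonneg: "0 \<le> weight S"
  using prior_const_pos lam_pos by (simp add: weight_def)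

text \<open>A vector from model \<open>S\<close> has its support inside \<open>S\<close>, so models
  of size at most \<open>t\<close> contribute nothing; the others are bounded pointwise in
  \<open>f\<close>.\<close>

lemma numerator_le:
  assumes W: "W \<beta>s Y \<le> n * C * g"
  shows "prior_integral a lam d (\<lambda>\<beta>. exp (L \<beta>s Y \<beta>) * of_bool (t < real (card (supp \<beta>))))
    \<le> (\<Sum>S\<in>Pow {0..<d}. ennreal (weight S * of_bool (t < real (card S))) * tilted S Y)"
  unfolding prior_integral_def weight_def[symmetric]
proof (rule sum_mono)
  fix S assume "S \<in> Pow {0..<d}"
  then have S: "S \<subseteq> {0..<d}" and fin: "finite S" using finite_subset by auto
  have supp_restr: "card (supp (restr S f)) \<le> card S" for f
    by (intro card_mono fin) (auto simp: supp_def restr_def)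
  let ?I = "\<integral>\<^sup>+f. ennreal (exp (- lam * l1norm S f) * (exp (L \<beta>s Y (restr S f))
      * of_bool (t < real (card (supp (restr S f)))))) \<partial>PiM S (\<lambda>_. lborel)"
  show "ennreal (weight S) * ?I \<le> ennreal (weight S * of_bool (t < real (card S))) * tilted S Y"
  proof (cases "t < real (card S)")
    case False
    then have "\<not> t < real (card (supp (restr S f)))" for f
      using supp_restr[of f] by linarith
    then show ?thesis by simp
  next
    case True
    have "?I \<le> tilted S Y"
      unfolding tilted_def
    proof (rule nn_integral_mono)
      fix f
      have "l1 (restr S f) = l1norm S f" by (rule l1norm_restr) (auto simp: S)
      then have 1: "L \<beta>s Y (restr S f) - lam * l1norm S f
          \<le> (1 - \<gamma>) * L \<beta>s Y (restr S f) - lam * l1 \<beta>s - lam / 4 * l1 (restr S f - \<beta>s) + Q"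
        using penalised_L_le[OF W restr_in_Rd[OF S, of f]] by simp
      have "(\<Sum>j\<in>S. \<bar>f j - \<beta>s j\<bar>) = (\<Sum>j\<in>S. \<bar>(restr S f - \<beta>s) j\<bar>)"
        by (rule sum.cong) (auto simp: restr_def)
      \<comment> \<open>Coordinates of the truth outside \<open>S\<close> add to the distance and
        are dropped.\<close>
      also have "\<dots> \<le> l1 (restr S f - \<beta>s)"
        unfolding l1norm_def using S by (intro sum_mono2) auto
      finally have "lam / 4 * (\<Sum>j\<in>S. \<bar>f j - \<beta>s j\<bar>) \<le> lam / 4 * l1 (restr S f - \<beta>s)"
        using lam_pos by (intro mult_left_mono) auto
      with 1 have "- lam * l1norm S f + L \<beta>s Y (restr S f)
          \<le> (Q - lam * l1 \<beta>s) + (- (lam / 4) * (\<Sum>j\<in>S. \<bar>f j - \<beta>s j\<bar>)) + (1 - \<gamma>) * L \<beta>s Y (restr S f)"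
        by linarith
      then have "exp (- lam * l1norm S f) * exp (L \<beta>s Y (restr S f))
          \<le> exp (Q - lam * l1 \<beta>s) * slab_dist S f * exp ((1 - \<gamma>) * L \<beta>s Y (restr S f))"
        unfolding slab_dist_def exp_add[symmetric] by simp
      moreover have "exp (- lam * l1norm S f) * (exp (L \<beta>s Y (restr S f)) * of_bool b)
          \<le> exp (- lam * l1norm S f) * exp (L \<beta>s Y (restr S f))" for b
        by simp
      ultimately have "exp (- lam * l1norm S f) * (exp (L \<beta>s Y (restr S f)) * of_bool (t < real (card (supp (restr S f)))))
          \<le> exp (Q - lam * l1 \<beta>s) * slab_dist S f * exp ((1 - \<gamma>) * L \<beta>s Y (restr S f))"
        by (rule order_trans[rotated])
      then show "ennreal (exp (- lam * l1norm S f) * (exp (L \<beta>s Y (restr S f))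
          * of_bool (t < real (card (supp (restr S f))))))
        \<le> ennreal (exp (Q - lam * l1 \<beta>s) * slab_dist S f) * ennreal (exp ((1 - \<gamma>) * L \<beta>s Y (restr S f)))"
        by (subst ennreal_mult[symmetric]) (auto intro: ennreal_leI simp: slab_dist_def)
    qed
    then show ?thesis using True by (simp add: mult_left_mono)
  qed
qed

section \<open>The dimension threshold and the expected posterior mass\<close>

definition threshold :: real where
  "threshold = s * (1 + 8 / (a - 1) * (1 + 49 * (nX * Mc)\<^sup>2 / (8 * \<phi>\<^sup>2)))"

text \<open>Beyond the threshold the geometric factor \<open>4 / real d powr a\<close> is below one,
  so every size is bounded by its value at the threshold. The threshold is calibrated to beat
  \<open>den\<close> with a factor \<open>1 / d\<close> to spare.\<close>

lemma weighted_sum_le: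
  "(\<Sum>S\<in>Pow {0..<d}. weight S * of_bool (threshold < real (card S)) * (exp (Q - lam * l1 \<beta>s) * (8 / lam) ^ card S))
    \<le> den / d"
proof -
  define q where "q = (nX * Mc)\<^sup>2 / \<phi>\<^sup>2"
  \<comment> \<open>\<open>E\<close> is the excess of the threshold over the true size;
    multiplication by \<open>a - 1\<close> clears its denominator.\<close>
  define E where "E = s * (8 + 49 * q) / (a - 1)"
  have q: "0 \<le> q" by (simp add: q_def)
  have E: "0 \<le> E" "(a - 1) * E = s * (8 + 49 * q)" using a_gt_1 q by (auto simp: E_def)
  have t: "threshold = s + E"
    using a_gt_1 phi_pos by (simp add: threshold_def E_def q_def field_simps)
  have d: "0 < d" using n_less_d by simp
  have s1: "1 \<le> s" using supp_pos by linarith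
  have ln4: "ln 4 \<le> ln d"
  proof -
    have "ln (4 :: real) = 2 * ln 2" using ln_realpow[of 2 2] by simp
    then show ?thesis using ln_d_ge ln_2_less_1 by linarith
  qed
  let ?c = "prior_const a d * exp (Q - lam * l1 \<beta>s)"
  have term_le: "of_bool (threshold < real k) * (4 / real d powr a) ^ k \<le> exp (threshold * (ln 4 - a * ln d))" for k
  proof (cases "threshold < real k")
    case True
    have "ln d \<le> a * ln d" using a_gt_1 ln_d_ge by simp
    then have "ln 4 - a * ln d \<le> 0" using ln4 by linarith
    then have "real k * (ln 4 - a * ln d) \<le> threshold * (ln 4 - a * ln d)"
      using True by (intro mult_right_mono_neg) auto
    moreover have "(4 / real d powr a) = exp (ln 4 - a * ln d)"
      using d by (simp add: exp_diff powr_def)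
    ultimately show ?thesis using True by (simp flip: exp_of_nat_mult)
  qed simp
  have "(\<Sum>S\<in>Pow {0..<d}. weight S * of_bool (threshold < real (card S)) * (exp (Q - lam * l1 \<beta>s) * (8 / lam) ^ card S))
    = (\<Sum>S\<in>Pow {0..<d}. inverse (real (d choose card S)) * (?c * (of_bool (threshold < real (card S)) * (4 / real d powr a) ^ card S)))"
  proof (rule sum.cong[OF refl])
    fix S :: "nat set"
    have "(lam / (2 * real d powr a)) ^ card S * (8 / lam) ^ card S = (4 / real d powr a) ^ card S"
      using lam_pos by (simp flip: power_mult_distrib)
    then have eq: "(4 / real d powr a) ^ card S = (lam / (2 * real d powr a)) ^ card S * (8 / lam) ^ card S" ..
    show "weight S * of_bool (threshold < real (card S)) * (exp (Q - lam * l1 \<beta>s) * (8 / lam) ^ card S)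
        = inverse (real (d choose card S)) * (?c * (of_bool (threshold < real (card S)) * (4 / real d powr a) ^ card S))"
      unfolding eq weight_def by (simp only: mult_ac)
  qed
  also have "\<dots> = (\<Sum>k\<le>d. ?c * (of_bool (threshold < real k) * (4 / real d powr a) ^ k))"
    by (rule sum_Pow_by_card)
  also have "\<dots> \<le> (\<Sum>k\<le>d. ?c * exp (threshold * (ln 4 - a * ln d)))"
    using prior_const_pos term_le by (intro sum_mono mult_left_mono) auto
  also have "\<dots> = (real d + 1) * (?c * exp (threshold * (ln 4 - a * ln d)))"
    by simp
  \<comment> \<open>The number of model sizes, \<open>d + 1\<close>, is paid for by two powers of
    \<open>d\<close>.\<close>
  also have "\<dots> \<le> exp (2 * ln d) * (?c * exp (threshold * (ln 4 - a * ln d)))"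
  proof (rule mult_right_mono)
    have "2 \<le> d" using exp_ge_add_one_self[of "ln d"] ln_d_ge exp_ln_d by linarith
    then have "2 * real d \<le> real d * real d" by simp
    moreover have "exp (2 * ln d) = real d * real d"
      unfolding mult_2 exp_add exp_ln_d ..
    ultimately show "real d + 1 \<le> exp (2 * ln d)" using \<open>2 \<le> d\<close> by linarith
  qed (use prior_const_pos in auto)
  also have "\<dots> = prior_const a d * exp (2 * ln d + Q - lam * l1 \<beta>s + threshold * (ln 4 - a * ln d))"
    by (simp add: exp_add exp_diff)
  also have "\<dots> \<le> prior_const a d * exp (- lam * l1 \<beta>s - (a + 4) * s * ln d - ln d)"
  proof -
    \<comment> \<open>For the excess coordinates one of the \<open>a\<close> powers of
      \<open>d\<close> absorbs the slab cost 4, and \<open>a - 1\<close> powers remain as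
      gain.\<close>
    have "threshold * (ln 4 - a * ln d) = s * ln 4 - a * s * ln d + E * (ln 4 - ln d) - ((a - 1) * E) * ln d"
      unfolding t by (simp add: algebra_simps)
    also have "\<dots> \<le> s * ln d - a * s * ln d + 0 - (s * (8 + 49 * q)) * ln d"
    proof -
      have "s * ln 4 \<le> s * ln d" using ln4 by (intro mult_left_mono) auto
      moreover have "E * (ln 4 - ln d) \<le> 0" using ln4 E by (intro mult_nonneg_nonpos) auto
      ultimately show ?thesis unfolding E by linarith
    qed
    finally have 1: "threshold * (ln 4 - a * ln d) \<le> s * ln d - a * s * ln d - (s * (8 + 49 * q)) * ln d" by simp
    have "0 \<le> s * ln d * q" using q ln_d_ge by simp
    moreover have "Q = s * ln d * q" by (simp add: Q_def q_def)
    moreover have "ln d \<le> s * ln d" using s1 ln_d_ge by simp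
    \<comment> \<open>In units of \<open>ln d\<close>: \<open>s - 8 * s\<close> splits into
      \<open>- 4 * s\<close>, demanded by \<open>den\<close>, and \<open>- 3 * s\<close>, which is
      at most -3 and pays for the number of sizes and the spare \<open>1 / d\<close>. The part
      \<open>49 * s * q\<close> covers \<open>Q\<close>.\<close>
    ultimately have "2 * ln d + Q + threshold * (ln 4 - a * ln d) \<le> - ((a + 4) * s * ln d) - ln d"
      using 1 by (simp add: algebra_simps)
    then show ?thesis using prior_const_pos by (intro mult_left_mono) auto
  qed
  also have "\<dots> = den / d"
    using d exp_ln_d unfolding den_def by (simp add: exp_diff exp_minus exp_add divide_inverse)
  finally show ?thesis .
qed

text \<open>On the noisy event the posterior is at most one, which costs \<open>1 / g\<close>.
  Elsewhere the numerator majorant divided by \<open>den\<close> has expectation at most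
  \<open>1 / d\<close>.\<close>

lemma expected_posterior_le:
  "(\<integral>\<^sup>+Y. posterior \<mu> h T A A1 \<eta> X n d a lam \<beta>s Y (\<lambda>\<beta>. threshold < real (card (supp \<beta>))) \<partial>data \<beta>s)
    \<le> ennreal (1 / g + 1 / d)"
proof -
  let ?t = threshold
  define bad where "bad = {Y \<in> space (data \<beta>s). n * C * g < W \<beta>s Y}"
  have bad_meas [measurable]: "bad \<in> sets (data \<beta>s)" unfolding bad_def by measurable
  define N where "N Y = (\<Sum>S\<in>Pow {0..<d}. ennreal (weight S * of_bool (?t < real (card S))) * tilted S Y)" for Y
  have term_meas: "(\<lambda>Y. ennreal (weight S * of_bool (?t < real (card S))) * tilted S Y) \<in> borel_measurable (data \<beta>s)"
    if "S \<subseteq> {0..<d}" for S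
    by (rule borel_measurable_times_ennreal[OF borel_measurable_const tilted_measurable[OF that]])
  have [measurable]: "N \<in> borel_measurable (data \<beta>s)"
    unfolding N_def by (intro borel_measurable_sum term_meas) auto
  \<comment> \<open>A majorant measurable in \<open>Y\<close> lets the integral be split without a
    measurability proof for the posterior itself.\<close>
  have pointwise: "posterior \<mu> h T A A1 \<eta> X n d a lam \<beta>s Y (\<lambda>\<beta>. ?t < real (card (supp \<beta>)))
      \<le> indicator bad Y + ennreal (1 / den) * N Y" if "Y \<in> space (data \<beta>s)" for Y
  proof (cases "Y \<in> bad")
    case True
    have "prior_integral a lam d (\<lambda>\<beta>. exp (L \<beta>s Y \<beta>) * of_bool (?t < real (card (supp \<beta>))))
        \<le> prior_integral a lam d (\<lambda>\<beta>. exp (L \<beta>s Y \<beta>))"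
      unfolding prior_integral_def
      by (intro sum_mono mult_left_mono nn_integral_mono ennreal_leI) auto
    then have "posterior \<mu> h T A A1 \<eta> X n d a lam \<beta>s Y (\<lambda>\<beta>. ?t < real (card (supp \<beta>))) \<le> 1"
      unfolding posterior_def
      \<comment> \<open>A zero normalizer forces a zero numerator, and \<open>0 / 0 = 0\<close> in
        \<open>ennreal\<close>.\<close>
      by (cases "prior_integral a lam d (\<lambda>\<beta>. exp (L \<beta>s Y \<beta>)) = 0")
        (auto intro!: divide_le_posI_ennreal simp: zero_less_iff_neq_zero)
    then show ?thesis using True by (simp add: add_increasing2)
  next
    case False
    then have W: "W \<beta>s Y \<le> n * C * g" using that by (auto simp: bad_def not_less)
    let ?D = "prior_integral a lam d (\<lambda>\<beta>. exp (L \<beta>s Y \<beta>))"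
    have D: "ennreal den \<le> ?D" by (rule denominator_ge[OF W])
    have "posterior \<mu> h T A A1 \<eta> X n d a lam \<beta>s Y (\<lambda>\<beta>. ?t < real (card (supp \<beta>))) \<le> N Y / ?D"
      unfolding posterior_def N_def by (intro divide_right_mono_ennreal numerator_le[OF W])
    also have "\<dots> \<le> ennreal (1 / den) * N Y"
    proof (rule divide_le_posI_ennreal)
      show "0 < ?D" using D den_pos by (meson ennreal_less_zero_iff less_le_trans)
      have "N Y = ennreal den * (ennreal (1 / den) * N Y)"
      proof -
        have "ennreal den * ennreal (1 / den) = 1"
          using den_pos by (simp flip: ennreal_mult)
        then show ?thesis by (simp flip: mult.assoc)
      qed
      also have "\<dots> \<le> ?D * (ennreal (1 / den) * N Y)"
        by (intro mult_right_mono D) auto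
      finally show "N Y \<le> ?D * (ennreal (1 / den) * N Y)" .
    qed
    finally show ?thesis using False by simp
  qed
  have N_int: "(\<integral>\<^sup>+Y. N Y \<partial>data \<beta>s) \<le> ennreal (den / d)"
  proof -
    have "(\<integral>\<^sup>+Y. N Y \<partial>data \<beta>s)
        = (\<Sum>S\<in>Pow {0..<d}. \<integral>\<^sup>+Y. ennreal (weight S * of_bool (?t < real (card S))) * tilted S Y \<partial>data \<beta>s)"
      unfolding N_def by (intro nn_integral_sum term_meas) auto
    also have "\<dots> \<le> (\<Sum>S\<in>Pow {0..<d}. ennreal (weight S * of_bool (?t < real (card S))
        * (exp (Q - lam * l1 \<beta>s) * (8 / lam) ^ card S)))"
    proof (rule sum_mono)
      fix S assume "S \<in> Pow {0..<d}"
      then have S: "S \<subseteq> {0..<d}" by auto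
      have "(\<integral>\<^sup>+Y. ennreal (weight S * of_bool (?t < real (card S))) * tilted S Y \<partial>data \<beta>s)
          = ennreal (weight S * of_bool (?t < real (card S))) * (\<integral>\<^sup>+Y. tilted S Y \<partial>data \<beta>s)"
        by (rule nn_integral_cmult[OF tilted_measurable[OF S]])
      also have "\<dots> \<le> ennreal (weight S * of_bool (?t < real (card S)))
          * ennreal (exp (Q - lam * l1 \<beta>s) * (8 / lam) ^ card S)"
        by (intro mult_left_mono nn_integral_tilted_le S) auto
      also have "\<dots> = ennreal (weight S * of_bool (?t < real (card S))
          * (exp (Q - lam * l1 \<beta>s) * (8 / lam) ^ card S))"
        using weight_nonneg lam_pos by (intro ennreal_mult[symmetric]) auto
      finally show "(\<integral>\<^sup>+Y. ennreal (weight S * of_bool (?t < real (card S))) * tilted S Y \<partial>data \<beta>s)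
          \<le> ennreal (weight S * of_bool (?t < real (card S)) * (exp (Q - lam * l1 \<beta>s) * (8 / lam) ^ card S))" .
    qed
    also have "\<dots> = ennreal (\<Sum>S\<in>Pow {0..<d}. weight S * of_bool (?t < real (card S))
        * (exp (Q - lam * l1 \<beta>s) * (8 / lam) ^ card S))"
      using weight_nonneg lam_pos by (intro sum_ennreal) auto
    also have "\<dots> \<le> ennreal (den / d)" by (intro ennreal_leI weighted_sum_le)
    finally show ?thesis .
  qed
  have "(\<integral>\<^sup>+Y. posterior \<mu> h T A A1 \<eta> X n d a lam \<beta>s Y (\<lambda>\<beta>. ?t < real (card (supp \<beta>))) \<partial>data \<beta>s)
      \<le> (\<integral>\<^sup>+Y. indicator bad Y + ennreal (1 / den) * N Y \<partial>data \<beta>s)"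
    by (rule nn_integral_mono) (rule pointwise)
  also have "\<dots> = emeasure (data \<beta>s) bad + ennreal (1 / den) * (\<integral>\<^sup>+Y. N Y \<partial>data \<beta>s)"
    using bad_meas by (subst nn_integral_add) (auto simp: nn_integral_cmult)
  also have "\<dots> \<le> ennreal (1 / g) + ennreal (1 / den) * ennreal (den / d)"
    using N_int W_tail[OF C_ge(1), of g \<beta>s] g_ge_1 n_pos
    by (intro add_mono mult_left_mono) (auto simp: bad_def)
  also have "\<dots> = ennreal (1 / g + 1 / d)"
    using den_pos g_ge_1 by (simp add: ennreal_mult'[symmetric])
  finally show ?thesis .
qed

end

subsection \<open>The asymptotic statement\<close>

lemma normX_ge:
  assumes "i < n" "j < d"
  shows "\<bar>Xn i j\<bar> \<le> normX Xn n d"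
  unfolding normX_def by (rule Max_ge) (use assms in \<open>auto intro: finite_image_set2\<close>)

lemma M1_ge_1: "0 < M0 \<Longrightarrow> 1 \<le> M1 M0"
  unfolding M1_def by (subst one_le_inverse_iff) (auto simp: min_less_iff_conj)

theorem theorem2:
  fixes \<mu> :: "real measure"
    and h T A A1 A2 :: "real \<Rightarrow> real"
    and Theta :: "real set"
    and \<eta> :: "real \<Rightarrow> real"
    and M0 :: real
    and d :: "nat \<Rightarrow> nat"
    and X :: "nat \<Rightarrow> nat \<Rightarrow> nat \<Rightarrow> real"
    and a lam b :: "nat \<Rightarrow> real"
    and phi1 :: "nat \<Rightarrow> nat set \<Rightarrow> real"
    and Bn :: "nat \<Rightarrow> (nat \<Rightarrow> real) set"
  assumes base: "sets \<mu> = sets borel"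
    and h_meas: "h \<in> borel_measurable borel" and h_nonneg: "\<forall>y. 0 \<le> h y"
    and T_meas: "T \<in> borel_measurable borel"
    and dom_def: "Theta = {\<theta>. integrable \<mu> (\<lambda>y. h y * exp (\<theta> * T y))}"
    and A_logpart: "\<forall>\<theta>\<in>Theta. A \<theta> = ln (\<integral>y. h y * exp (\<theta> * T y) \<partial>\<mu>)"
    and A_convex: "convex_on Theta A"
    and A1_deriv: "\<forall>t\<in>Theta. (A has_real_derivative A1 t) (at t within Theta)"
    and A2_deriv: "\<forall>t\<in>Theta. (A1 has_real_derivative A2 t) (at t within Theta)"
    and IA_interval: "\<forall>bb::ereal. 0 < bb \<longrightarrow> is_interval (IA Theta A2 bb)"
    and M0_pos: "0 < M0"
    and eta_lip: "\<exists>K. K-lipschitz_on UNIV \<eta>"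
    and eta_inj: "inj \<eta>"
    and eta_range: "range \<eta> \<subseteq> IA Theta A2 (ereal (M0\<^sup>2 / 2))"
    and a_gt1: "\<forall>n. 1 < a n"
    and L0: "\<forall>n. McalAX M0 (X n) n (d n) / real (d n) \<le> lam n
                 \<and> lam n \<le> McalAX M0 (X n) n (d n) * sqrt (ln (real (d n)))"
    and d_gt_n: "\<forall>n. n < d n"
    and b_pos: "\<forall>n. 0 < b n"
    and b_small: "b \<in> o(\<lambda>n. real n / ln (real (d n)))"
    and b_large_n: "eventually (\<lambda>n. b n * ln (real (d n)) < real n) sequentially"
    and phi1_prop: "\<forall>n. \<forall>S \<subseteq> {0..<d n}. 0 \<le> phi1 n S \<and>
          (\<forall>\<beta>1\<in>Rd (d n). \<forall>\<beta>2\<in>Rd (d n).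
             restr S \<beta>1 \<noteq> restr S \<beta>2 \<and>
             l1norm ({0..<d n} - S) (\<beta>2 - \<beta>1) < 7 * l1norm S (\<beta>2 - \<beta>1) \<longrightarrow>
             real n * (phi1 n S)\<^sup>2 / real (card S) * (l1norm S (\<beta>2 - \<beta>1))\<^sup>2
               \<le> Dn A A1 n (etas \<eta> (X n) (d n) \<beta>1) (etas \<eta> (X n) (d n) \<beta>2))"
    and IC_model: "\<forall>n. \<exists>S \<subseteq> {0..<d n}. S \<noteq> {} \<and> 0 < phi1 n S"
    and Bn_def: "\<forall>n. Bn n = {\<beta> \<in> Rd (d n). 0 < phi1 n (supp \<beta>)
                        \<and> 0 < card (supp \<beta>) \<and> real (card (supp \<beta>)) \<le> b n}"
    and IC_joint: "\<forall>n. Bn n \<noteq> {}"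
  shows "(\<lambda>n. SUP \<beta>s\<in>Bn n.
            \<integral>\<^sup>+ Y. posterior \<mu> h T A A1 \<eta> (X n) n (d n) (a n) (lam n) \<beta>s Y
                 (\<lambda>\<beta>. real (card (supp \<beta>)) >
                      real (card (supp \<beta>s)) * (1 + 8 / (a n - 1)
                        * (1 + 49 * (McalAX M0 (X n) n (d n))\<^sup>2 / (8 * (phi1 n (supp \<beta>s))\<^sup>2))))
            \<partial>(data_measure \<mu> h T A n (etas \<eta> (X n) (d n) \<beta>s)))
         \<longlonglongrightarrow> 0"
proof -
  obtain K0 where K0: "K0-lipschitz_on UNIV \<eta>" using eta_lip by blast
  define K where "K = max 1 K0"
  have K_lip: "K-lipschitz_on UNIV \<eta>" using K0 by (rule lipschitz_on_mono) (auto simp: K_def)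
  have K1: "1 \<le> K" by (simp add: K_def)
  define m where "m = M0\<^sup>2 / 2"
  define C where "C = max (1 + 4 * m) (M1 M0)"
  have M1: "1 \<le> M1 M0" using M1_ge_1[OF M0_pos] .
  have cont: "continuous_on UNIV \<eta>" using K_lip by (rule lipschitz_on_continuous_on)
  \<comment> \<open>An injective continuous map of the line is open, so \<open>range \<eta>\<close>
    is an open interval, on which derivatives relative to \<open>Theta\<close> become
    two-sided.\<close>
  have open_I: "open (range \<eta>)"
    by (rule injective_into_1d_imp_open_map_UNIV[OF open_UNIV cont eta_inj]) auto
  have int_I: "is_interval (range \<eta>)"
    unfolding is_interval_connected_1 using cont connected_UNIV by (rule connected_continuous_image)
  have I_sub: "range \<eta> \<subseteq> Theta" using eta_range by (auto simp: IA_def)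
  have A2_range: "0 \<le> A2 t" "A2 t \<le> m" if "t \<in> range \<eta>" for t
    using eta_range that by (auto simp: IA_def m_def)
  have at_I: "at t within Theta = at t" if "t \<in> range \<eta>" for t
    by (rule at_within_open_subset[OF that open_I I_sub])
  have A_der: "(A has_real_derivative A1 t) (at t)" "(A1 has_real_derivative A2 t) (at t)" if "t \<in> range \<eta>" for t
    using A1_deriv A2_deriv at_I[OF that] I_sub that by (metis subsetD)+
  have kernel: "integrable \<mu> (\<lambda>y. h y * exp (\<theta> * T y))" if "\<theta> \<in> Theta" for \<theta>
    using that unfolding dom_def by simp
  have etas_I: "etas \<eta> Xn dn \<beta> i \<in> range \<eta>" for Xn dn \<beta> i by (simp add: etas_def)

  \<comment> \<open>IC(Joint) yields a strictly positive divergence, which below excludes a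
    vanishing normalizing integral and a vanishing design.\<close>
  have Dn_pos: "\<exists>\<beta>1 \<beta>2. 0 < Dn A A1 n (etas \<eta> (X n) (d n) \<beta>1) (etas \<eta> (X n) (d n) \<beta>2)" if "0 < n" for n
  proof -
    obtain \<beta>s where \<beta>s: "\<beta>s \<in> Bn n" using IC_joint by blast
    then have b: "\<beta>s \<in> Rd (d n)" "0 < phi1 n (supp \<beta>s)" "0 < card (supp \<beta>s)"
      using Bn_def by auto
    then obtain j where j: "j \<in> supp \<beta>s" by (metis card.empty ex_in_conv less_irrefl)
    have fin: "finite (supp \<beta>s)" using b(3) card_ge_0_finite by blast
    have sub: "supp \<beta>s \<subseteq> {0..<d n}" using b(1) by (auto simp: supp_def Rd_def not_le)
    \<comment> \<open>A unit vector at an index of the support, compared with zero, has distance 1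
      on the support and 0 off it, hence lies in the cone.\<close>
    define \<beta>2 :: "nat \<Rightarrow> real" where "\<beta>2 = (\<lambda>k. if k = j then 1 else 0)"
    define \<beta>1 :: "nat \<Rightarrow> real" where "\<beta>1 = (\<lambda>k. 0)"
    have l1: "l1norm (supp \<beta>s) (\<beta>2 - \<beta>1) = 1"
      using fin j by (simp add: l1norm_def \<beta>1_def \<beta>2_def if_distrib[of abs] cong: if_cong)
    have l0: "l1norm ({0..<d n} - supp \<beta>s) (\<beta>2 - \<beta>1) = 0"
      unfolding l1norm_def using j by (intro sum.neutral) (auto simp: \<beta>1_def \<beta>2_def)
    have "restr (supp \<beta>s) \<beta>1 j \<noteq> restr (supp \<beta>s) \<beta>2 j"
      using j by (simp add: restr_def \<beta>1_def \<beta>2_def)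
    then have ne: "restr (supp \<beta>s) \<beta>1 \<noteq> restr (supp \<beta>s) \<beta>2" by metis
    have "\<beta>1 \<in> Rd (d n)" "\<beta>2 \<in> Rd (d n)" using j sub by (auto simp: Rd_def \<beta>1_def \<beta>2_def)
    moreover have "l1norm ({0..<d n} - supp \<beta>s) (\<beta>2 - \<beta>1) < 7 * l1norm (supp \<beta>s) (\<beta>2 - \<beta>1)"
      using l1 l0 by simp
    ultimately have "real n * (phi1 n (supp \<beta>s))\<^sup>2 / real (card (supp \<beta>s)) * (l1norm (supp \<beta>s) (\<beta>2 - \<beta>1))\<^sup>2
        \<le> Dn A A1 n (etas \<eta> (X n) (d n) \<beta>1) (etas \<eta> (X n) (d n) \<beta>2)"
      using phi1_prop sub ne by blast
    moreover have "0 < real n * (phi1 n (supp \<beta>s))\<^sup>2 / real (card (supp \<beta>s)) * (l1norm (supp \<beta>s) (\<beta>2 - \<beta>1))\<^sup>2"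
      using b \<open>0 < n\<close> l1 by simp
    ultimately show ?thesis by (meson less_le_trans)
  qed

  \<comment> \<open>Were the integral zero, \<open>h\<close> would vanish almost everywhere and, by
    the convention \<open>ln 0 = 0\<close>, \<open>A\<close> would be zero on all of
    \<open>range \<eta>\<close>; every divergence would then be zero.\<close>
  have kernel_pos: "0 < (\<integral>y. h y * exp (\<theta> * T y) \<partial>\<mu>)" if \<theta>: "\<theta> \<in> range \<eta>" for \<theta>
  proof (rule ccontr)
    assume "\<not> 0 < (\<integral>y. h y * exp (\<theta> * T y) \<partial>\<mu>)"
    moreover have "0 \<le> (\<integral>y. h y * exp (\<theta> * T y) \<partial>\<mu>)" using h_nonneg by (intro Bochner_Integration.integral_nonneg) simp
    ultimately have "(\<integral>y. h y * exp (\<theta> * T y) \<partial>\<mu>) = 0" by simp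
    then have ae: "AE y in \<mu>. h y = 0"
      using integral_nonneg_eq_0_iff_AE[OF kernel[of \<theta>]] h_nonneg \<theta> I_sub by auto
    have A0: "A t = 0" if "t \<in> range \<eta>" for t
    proof -
      have "(\<integral>y. h y * exp (t * T y) \<partial>\<mu>) = 0"
        using ae by (intro integral_eq_zero_AE) auto
      then show ?thesis using A_logpart I_sub that by auto
    qed
    have "A1 t = 0" if "t \<in> range \<eta>" for t
    proof (rule DERIV_unique)
      show "(A has_real_derivative A1 t) (at t)" using A_der that by blast
      show "(A has_real_derivative 0) (at t)"
        by (rule has_field_derivative_transform_within_open[of "\<lambda>_. 0" _ _ "range \<eta>"])
          (use open_I that A0 in auto)
    qed
    then have "Dn A A1 1 (etas \<eta> (X 1) (d 1) \<beta>1) (etas \<eta> (X 1) (d 1) \<beta>2) = 0" for \<beta>1 \<beta>2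
      using A0 etas_I by (simp add: Dn_def)
    then show False using Dn_pos[of 1] by simp
  qed

  interpret fam: regular_exponential_family \<mu> h T A A1 A2 "range \<eta>" m
  proof
    show "(\<integral>y. h y * exp (\<theta> * T y) \<partial>\<mu>) = exp (A \<theta>)" if "\<theta> \<in> range \<eta>" for \<theta>
      using kernel_pos[OF that] A_logpart I_sub that by auto
  qed (use base h_meas h_nonneg T_meas open_I int_I kernel I_sub A_der A2_range in auto)

  \<comment> \<open>With a zero design all coefficient vectors give the same natural parameters,
    contradicting \<open>Dn_pos\<close>.\<close>
  have nX_pos: "0 < normX (X n) n (d n)" if "0 < n" for n
  proof (rule ccontr)
    assume "\<not> 0 < normX (X n) n (d n)"
    then have X0: "X n i j = 0" if "i < n" "j < d n" for i j
      using normX_ge[OF that, of "X n"] by simp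
    have "Dn A A1 n (etas \<eta> (X n) (d n) \<beta>1) (etas \<eta> (X n) (d n) \<beta>2) = 0" for \<beta>1 \<beta>2
      unfolding Dn_def etas_def by (intro sum.neutral ballI) (simp add: X0)
    then show False using Dn_pos[OF that] by simp
  qed

  \<comment> \<open>The fourth root tends to infinity, so \<open>1 / g n\<close> vanishes, while its
    product with \<open>sqrt (ln (real (d n)))\<close> is a 3/4 power of
    \<open>ln (real (d n))\<close> and leaves room for every constant.\<close>
  define g where "g n = sqrt (sqrt (ln (real (d n))))" for n
  have d_lim: "filterlim (\<lambda>n. real (d n)) at_top sequentially"
    by (rule filterlim_at_top_mono[OF filterlim_real_sequentially])
      (use d_gt_n in \<open>auto intro!: always_eventually less_imp_le\<close>)
  have ln_lim: "filterlim (\<lambda>n. ln (real (d n))) at_top sequentially"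
    by (rule filterlim_compose[OF ln_at_top d_lim])

  have "\<forall>\<^sub>F x in at_top. (K * C) * sqrt (sqrt x) + (m * K\<^sup>2 + M1 M0) \<le> x"
    by real_asymp
  moreover have "\<forall>\<^sub>F x in at_top. (9 / 4 * K * C) * (sqrt (sqrt x) * sqrt x) \<le> x"
    by real_asymp
  ultimately have ev_x: "\<forall>\<^sub>F x in at_top. K * C * sqrt (sqrt x) + m * K\<^sup>2 + M1 M0 \<le> x
      \<and> 9 / 4 * K * C * sqrt (sqrt x) * sqrt x \<le> x \<and> 2 \<le> x"
    using eventually_ge_at_top[of "2 :: real"] by eventually_elim (simp add: algebra_simps)
  have ev: "\<forall>\<^sub>F n in sequentially. K * C * g n + m * K\<^sup>2 + M1 M0 \<le> ln (real (d n))
      \<and> 9 / 4 * K * C * g n * sqrt (ln (real (d n))) \<le> ln (real (d n)) \<and> 2 \<le> ln (real (d n))"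
    using eventually_compose_filterlim[OF ev_x ln_lim] by (simp add: g_def)

  let ?F = "\<lambda>n \<beta>s. \<integral>\<^sup>+ Y. posterior \<mu> h T A A1 \<eta> (X n) n (d n) (a n) (lam n) \<beta>s Y
                 (\<lambda>\<beta>. real (card (supp \<beta>)) >
                      real (card (supp \<beta>s)) * (1 + 8 / (a n - 1)
                        * (1 + 49 * (McalAX M0 (X n) n (d n))\<^sup>2 / (8 * (phi1 n (supp \<beta>s))\<^sup>2))))
            \<partial>(data_measure \<mu> h T A n (etas \<eta> (X n) (d n) \<beta>s))"
  have bound: "\<forall>\<^sub>F n in sequentially. (SUP \<beta>s\<in>Bn n. ?F n \<beta>s) \<le> ennreal (1 / g n + 1 / d n)"
    using ev b_large_n eventually_gt_at_top[of 0]
  proof eventually_elim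
    case (elim n)
    show ?case
    proof (rule SUP_least)
      fix \<beta>s assume "\<beta>s \<in> Bn n"
      then have b: "\<beta>s \<in> Rd (d n)" "0 < phi1 n (supp \<beta>s)" "0 < card (supp \<beta>s)"
          "real (card (supp \<beta>s)) \<le> b n"
        using Bn_def by auto
      have sub: "supp \<beta>s \<subseteq> {0..<d n}" using b(1) by (auto simp: supp_def Rd_def not_le)
      \<comment> \<open>The truth has a nonempty support of size at most \<open>b n\<close>; this
        turns the condition on \<open>b n\<close> into
        \<open>ln (real (d n)) \<le> n\<close>.\<close>
      have "1 \<le> b n" using b by linarith
      then have "1 * ln (real (d n)) \<le> b n * ln (real (d n))" using elim by (intro mult_right_mono) auto
      then have ln_le: "ln (real (d n)) \<le> n" using elim by linarith
      interpret sparse_truth \<mu> h T A A1 A2 \<eta> m K "normX (X n) n (d n)" n "d n" "X n"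
        "M1 M0" C "g n" "a n" "lam n" "phi1 n (supp \<beta>s)" \<beta>s
      proof
        show "real n * (phi1 n (supp \<beta>s))\<^sup>2 / real (card (supp \<beta>s)) * (l1norm (supp \<beta>s) (\<beta> - \<beta>s))\<^sup>2
            \<le> Dn A A1 n (etas \<eta> (X n) (d n) \<beta>s) (etas \<eta> (X n) (d n) \<beta>)"
          if "\<beta> \<in> Rd (d n)" "restr (supp \<beta>s) \<beta>s \<noteq> restr (supp \<beta>s) \<beta>"
            "l1norm ({0..<d n} - supp \<beta>s) (\<beta> - \<beta>s) < 7 * l1norm (supp \<beta>s) (\<beta> - \<beta>s)" for \<beta>
          using phi1_prop sub b(1) that by blast
        show "1 \<le> g n" using elim by (simp add: g_def)
        show "normX (X n) n (d n) * M1 M0 / real (d n) \<le> lam n"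
          "lam n \<le> normX (X n) n (d n) * M1 M0 * sqrt (ln (real (d n)))"
          using L0 by (auto simp: McalAX_def)
      qed (use K_lip normX_ge nX_pos[of n] elim d_gt_n K1 M1 a_gt1 ln_le b in \<open>auto simp: C_def less_imp_le\<close>)
      \<comment> \<open>The bound is free of \<open>\<beta>s\<close>, which gives uniformity over
        \<open>Bn n\<close>.\<close>
      show "?F n \<beta>s \<le> ennreal (1 / g n + 1 / d n)"
        using expected_posterior_le unfolding threshold_def McalAX_def .
    qed
  qed
  have g_lim: "filterlim g at_top sequentially"
    unfolding g_def by (intro filterlim_compose[OF sqrt_at_top] ln_lim)
  have "(\<lambda>n. 1 / g n + 1 / real (d n)) \<longlonglongrightarrow> 0 + 0"
    by (intro tendsto_add tendsto_divide_0[OF tendsto_const] filterlim_at_top_imp_at_infinity g_lim d_lim)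
  then have "(\<lambda>n. ennreal (1 / g n + 1 / real (d n))) \<longlonglongrightarrow> 0"
    using tendsto_ennrealI by fastforce
  then show ?thesis
    by (rule tendsto_sandwich[OF _ bound tendsto_const, rotated]) simp
qed

end
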